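(* Let $\mathcal{F}=\{F_1,\ldots,F_{22}\}$ be the explicit list of twenty-two graphs given in the context. Let $G$ be a finite undirected graph that is chordal and such that no induced subgraph of $G$ is isomorphic to a member of $\mathcal{F}$. Then $G$ is b-perfect, i.e. every induced subgraph $H$ of $G$ satisfies $b(H)=\chi(H)$.
   Context: All graphs are finite, undirected and simple. A coloring of a graph $G$ with $k$ colors is a map $c:V(G)\to\{1,\ldots,k\}$ with $c(u)\neq c(v)$ for all adjacent $u,v$; the nonempty sets among $c^{-1}(1),\ldots,c^{-1}(k)$ are the color classes. A b-coloring is a coloring such that every color class contains a vertex (called a b-vertex) that has a neighbour in each color class other than its own. The b-chromatic number $b(G)$ is the largest integer $k$ such that $G$ admits a b-coloring with exactly $k$ colors (i.e. $k$ color classes). $\chi(G)$ is the chromatic number. A graph $G$ is b-perfect if every induced subgraph $H$ of $G$ satisfies $b(H)=\chi(H)$. A graph is chordal if every cycle of length at least four has a chord (an edge between two non-consecutive vertices of the cycle). $P_k$ is the path on $k$ vertices, $+$ is disjoint union, and $nF$ is the disjoint union of $n$ copies of $F$. The class $\mathcal{F}=\{F_1,\ldots,F_{22}\}$ (for $F_4,\ldots,F_{22}$, the vertex set is the set of letters listed, and $xy$ denotes an edge joining $x$ and $y$): $F_1=P_5$; $F_2=P_4+P_3$; $F_3=3P_3$. $F_4$: vertices $a,b,c,d,e,f$; edges $ab,cd,ac,bd,ad,ea,ec,fb,fd$. $F_5$: vertices $l,m,p,q,r,s,t$; edges $lp,ls,ps,pm,sm,mq,mr,mt,qr,tr$. $F_6$: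 the disjoint union of two diamonds (a diamond is $K_4$ minus one edge). $F_7$: obtained from $F_6$ by adding one edge joining a degree-3 vertex of one diamond to a degree-3 vertex of the other. $F_8$: vertices $a_1,a_2,a_3,a_4,v,w,x,y$; edges $a_1a_2,a_2a_3,a_3a_4$, $va_i$ for $i=1,\ldots,4$, $vw,wx,wy,xy$. $F_9$: vertices $a_1,\ldots,a_6,v,w,x,y$; edges $a_1a_2,a_2a_3,a_4a_5,a_5a_6$, $va_i$ for $i=1,\ldots,6$, $vw,wx,wy,xy$. $F_{10}$: vertices $a,b,c,d,e,f$; edges $ab,cd,ac,bd,ad,ea,ec,fb,fd,ef$. $F_{11}$: vertices $l,m,p,q,r,s,t$; edges $lp,ls,ps,pm,sm,mq,mr,mt,qr,tr,lt,lq$. $F_{12}$: vertices $a_0,a_1,a_2,a_3,b_0,b_1,b_2,b_3$; edges $a_0a_1,a_1a_2,a_2a_3,b_0b_1,b_1b_2,b_2b_3,a_1b_1,a_2b_2,a_0b_1,a_1b_0,a_2b_3,a_3b_2$. $F_{13}$: vertices $a_0,a_1,a_2,a_3,b_0,b_1,b_2,b_3$; edges $a_0a_1,a_1a_2,a_2a_3,b_0b_1,b_1b_2,b_2b_3,a_0b_0,a_3b_3,a_0b_1,a_1b_2,a_2b_3,a_1b_0,a_2b_1,a_3b_2$. $F_{14}$: vertices $a_0,a_1,a_2,a_3,c,d,e,f$; edges $a_0a_1,a_1a_2,a_2a_3,ef,cd,a_0e,a_3f,a_0c,a_1d,a_2c,a_3d,ce,df,a_1e,a_2f$. $F_{15}$: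 vertices $a,b,c,d,e,f,g,h$; edges $ab,gh,cd,ef,ag,bh,cf,de,ae,dh,cg,bf,ac,fh,eg,bd$. $F_{16}$: vertices $p,q,l,r,m,n$; edges $pq,mn,qr,pl,mr,ml,nr,nl$. $F_{17}$: vertices $p,q,l,r,m,n$; edges $pq,mn,qr,pl,mr,ml,nr,nl,mq$. $F_{18}$: vertices $p,q,s,t,l,m,r,n$; edges $pq,qr,pl,nr,nl,ps,qt,sr,tl,sm,tm,sl,tr$. $F_{19}$: vertices $p,q,c,d,l,r,m,n$; edges $pq,cd,pc,qd,pl,qr,cm,dm,cn,dn,lm,rm,ln,rn$. $F_{20}$: vertices $p,q,s,t,l,m,r,n$; edges $pq,st,qr,pl,sq,nr,pt,ln,lm,mr,sl,tr,sm,tn$. $F_{21}$: vertices $p,q,s,t,l,m,r,n$; edges $pq,st,qr,pl,sq,nr,pt,ln,lm,mr,sl,tr,sm,tn,pm$. $F_{22}$: vertices $p,q,a,b,c,d,m,n$; edges $pq,ab,bc,cd,mn,qd,pa,nd,na,pc,qb,pm,qm,bn,cn$. *)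

theory Defs
  imports "Graph_Theory.Graph_Theory"
begin

text \<open>
  Finite simple undirected graphs are those satisfying the locale predicate \<^locale>\<open>graph\<close>, in which
  every edge is represented by two opposite arcs. The graph without vertices is allowed.
\<close>

section \<open>Colorings\<close>

definition coloring :: "('a,'b) pre_digraph \<Rightarrow> nat \<Rightarrow> ('a \<Rightarrow> nat) \<Rightarrow> bool" where
  "coloring G k c \<longleftrightarrow>
     (\<forall>v \<in> verts G. c v \<in> {1..k}) \<and> (\<forall>u v. u \<rightarrow>\<^bsub>G\<^esub> v \<longrightarrow> c u \<noteq> c v)"

definition color_classes :: "('a,'b) pre_digraph \<Rightarrow> nat \<Rightarrow> ('a \<Rightarrow> nat) \<Rightarrow> 'a set set" where
  "color_classes G k c = (\<lambda>i. {v \<in> verts G. c v = i}) ` {1..k} - {{}}"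

definition b_vertex :: "('a,'b) pre_digraph \<Rightarrow> nat \<Rightarrow> ('a \<Rightarrow> nat) \<Rightarrow> 'a \<Rightarrow> bool" where
  "b_vertex G k c v \<longleftrightarrow>
     v \<in> verts G \<and> (\<forall>C \<in> color_classes G k c. v \<notin> C \<longrightarrow> (\<exists>u \<in> C. v \<rightarrow>\<^bsub>G\<^esub> u))"

definition b_coloring :: "('a,'b) pre_digraph \<Rightarrow> nat \<Rightarrow> ('a \<Rightarrow> nat) \<Rightarrow> bool" where
  "b_coloring G k c \<longleftrightarrow>
     coloring G k c \<and> (\<forall>C \<in> color_classes G k c. \<exists>v \<in> C. b_vertex G k c v)"

definition b_chromatic_number :: "('a,'b) pre_digraph \<Rightarrow> nat" where
  "b_chromatic_number G = (GREATEST k. \<exists>c. b_coloring G k c \<and> card (color_classes G k c) = k)"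

definition chromatic_number :: "('a,'b) pre_digraph \<Rightarrow> nat" where
  "chromatic_number G = (LEAST k. \<exists>c. coloring G k c)"

definition b_perfect :: "('a,'b) pre_digraph \<Rightarrow> bool" where
  "b_perfect G \<longleftrightarrow>
     (\<forall>H. induced_subgraph H G \<longrightarrow> b_chromatic_number H = chromatic_number H)"


section \<open>Chordal graphs\<close>

text \<open>
  A cycle is a list of arcs; its vertices are the tails of these arcs. Two of its vertices are
  consecutive iff the cycle traverses an arc between them, in one of the two directions.
\<close>

definition chord :: "('a,'b) pre_digraph \<Rightarrow> 'b awalk \<Rightarrow> 'a \<Rightarrow> 'a \<Rightarrow> bool" where
  "chord G p u v \<longleftrightarrow>
     u \<in> tail G ` set p \<and> v \<in> tail G ` set p \<and> u \<rightarrow>\<^bsub>G\<^esub> v \<and>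
     (u, v) \<notin> arc_to_ends G ` set p \<and> (v, u) \<notin> arc_to_ends G ` set p"

definition chordal :: "('a,'b) pre_digraph \<Rightarrow> bool" where
  "chordal G \<longleftrightarrow>
     (\<forall>p. pre_digraph.cycle G p \<and> 4 \<le> length p \<longrightarrow> (\<exists>u v. chord G p u v))"


section \<open>The forbidden graphs\<close>

definition sgraph :: "'a set \<Rightarrow> ('a \<times> 'a) set \<Rightarrow> ('a, 'a \<times> 'a) pre_digraph" where
  "sgraph V E = with_proj \<lparr> pverts = V, parcs = E \<union> E\<inverse> \<rparr>"

definition path_on :: "'a list \<Rightarrow> ('a, 'a \<times> 'a) pre_digraph" where
  "path_on xs = sgraph (set xs) (set (zip xs (tl xs)))"

(* The missing edge of K4 is the one between c and d, so a and b have degree 3. *)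
definition diamond :: "'a \<Rightarrow> 'a \<Rightarrow> 'a \<Rightarrow> 'a \<Rightarrow> ('a, 'a \<times> 'a) pre_digraph" where
  "diamond a b c d = sgraph {a, b, c, d} {(a,b), (a,c), (a,d), (b,c), (b,d)}"

text \<open>
  In \<open>F2\<close>, \<open>F3\<close> and \<open>F6\<close> the arguments of \<^const>\<open>union\<close> have disjoint vertex sets.
\<close>

definition F1 :: "(nat, nat \<times> nat) pre_digraph" where
  "F1 = path_on [0, 1, 2, 3, 4]"

definition F2 :: "(nat, nat \<times> nat) pre_digraph" where
  "F2 = union (path_on [0, 1, 2, 3]) (path_on [4, 5, 6])"

definition F3 :: "(nat, nat \<times> nat) pre_digraph" where
  "F3 = union (path_on [0, 1, 2]) (union (path_on [3, 4, 5]) (path_on [6, 7, 8]))"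

definition F4 :: "(nat, nat \<times> nat) pre_digraph" where
  "F4 = (let a = 0; b = 1; c = 2; d = 3; e = 4; f = 5 in
    sgraph {a, b, c, d, e, f}
      {(a,b), (c,d), (a,c), (b,d), (a,d), (e,a), (e,c), (f,b),
       (f,d)})"

definition F5 :: "(nat, nat \<times> nat) pre_digraph" where
  "F5 = (let l = 0; m = 1; p = 2; q = 3; r = 4; s = 5; t = 6 in
    sgraph {l, m, p, q, r, s, t}
      {(l,p), (l,s), (p,s), (p,m), (s,m), (m,q), (m,r), (m,t),
       (q,r), (t,r)})"

definition F6 :: "(nat, nat \<times> nat) pre_digraph" where
  "F6 = union (diamond 0 1 2 3) (diamond 4 5 6 7)"

(* 0 and 4 have degree 3 in their diamonds. *)
definition F7 :: "(nat, nat \<times> nat) pre_digraph" where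
  "F7 = union F6 (path_on [0, 4])"

definition F8 :: "(nat, nat \<times> nat) pre_digraph" where
  "F8 = (let a\<^sub>1 = 0; a\<^sub>2 = 1; a\<^sub>3 = 2; a\<^sub>4 = 3; v = 4; w = 5; x = 6; y = 7 in
    sgraph {a\<^sub>1, a\<^sub>2, a\<^sub>3, a\<^sub>4, v, w, x, y}
      {(a\<^sub>1,a\<^sub>2), (a\<^sub>2,a\<^sub>3), (a\<^sub>3,a\<^sub>4), (v,a\<^sub>1), (v,a\<^sub>2), (v,a\<^sub>3), (v,a\<^sub>4), (v,w),
       (w,x), (w,y), (x,y)})"

definition F9 :: "(nat, nat \<times> nat) pre_digraph" where
  "F9 = (let a\<^sub>1 = 0; a\<^sub>2 = 1; a\<^sub>3 = 2; a\<^sub>4 = 3; a\<^sub>5 = 4; a\<^sub>6 = 5; v = 6; w = 7; x = 8; y = 9 in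
    sgraph {a\<^sub>1, a\<^sub>2, a\<^sub>3, a\<^sub>4, a\<^sub>5, a\<^sub>6, v, w, x, y}
      {(a\<^sub>1,a\<^sub>2), (a\<^sub>2,a\<^sub>3), (a\<^sub>4,a\<^sub>5), (a\<^sub>5,a\<^sub>6), (v,a\<^sub>1), (v,a\<^sub>2), (v,a\<^sub>3), (v,a\<^sub>4),
       (v,a\<^sub>5), (v,a\<^sub>6), (v,w), (w,x), (w,y), (x,y)})"

definition F10 :: "(nat, nat \<times> nat) pre_digraph" where
  "F10 = (let a = 0; b = 1; c = 2; d = 3; e = 4; f = 5 in
    sgraph {a, b, c, d, e, f}
      {(a,b), (c,d), (a,c), (b,d), (a,d), (e,a), (e,c), (f,b),
       (f,d), (e,f)})"

definition F11 :: "(nat, nat \<times> nat) pre_digraph" where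
  "F11 = (let l = 0; m = 1; p = 2; q = 3; r = 4; s = 5; t = 6 in
    sgraph {l, m, p, q, r, s, t}
      {(l,p), (l,s), (p,s), (p,m), (s,m), (m,q), (m,r), (m,t),
       (q,r), (t,r), (l,t), (l,q)})"

definition F12 :: "(nat, nat \<times> nat) pre_digraph" where
  "F12 = (let a\<^sub>0 = 0; a\<^sub>1 = 1; a\<^sub>2 = 2; a\<^sub>3 = 3; b\<^sub>0 = 4; b\<^sub>1 = 5; b\<^sub>2 = 6; b\<^sub>3 = 7 in
    sgraph {a\<^sub>0, a\<^sub>1, a\<^sub>2, a\<^sub>3, b\<^sub>0, b\<^sub>1, b\<^sub>2, b\<^sub>3}
      {(a\<^sub>0,a\<^sub>1), (a\<^sub>1,a\<^sub>2), (a\<^sub>2,a\<^sub>3), (b\<^sub>0,b\<^sub>1), (b\<^sub>1,b\<^sub>2), (b\<^sub>2,b\<^sub>3), (a\<^sub>1,b\<^sub>1), (a\<^sub>2,b\<^sub>2),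
       (a\<^sub>0,b\<^sub>1), (a\<^sub>1,b\<^sub>0), (a\<^sub>2,b\<^sub>3), (a\<^sub>3,b\<^sub>2)})"

definition F13 :: "(nat, nat \<times> nat) pre_digraph" where
  "F13 = (let a\<^sub>0 = 0; a\<^sub>1 = 1; a\<^sub>2 = 2; a\<^sub>3 = 3; b\<^sub>0 = 4; b\<^sub>1 = 5; b\<^sub>2 = 6; b\<^sub>3 = 7 in
    sgraph {a\<^sub>0, a\<^sub>1, a\<^sub>2, a\<^sub>3, b\<^sub>0, b\<^sub>1, b\<^sub>2, b\<^sub>3}
      {(a\<^sub>0,a\<^sub>1), (a\<^sub>1,a\<^sub>2), (a\<^sub>2,a\<^sub>3), (b\<^sub>0,b\<^sub>1), (b\<^sub>1,b\<^sub>2), (b\<^sub>2,b\<^sub>3), (a\<^sub>0,b\<^sub>0), (a\<^sub>3,b\<^sub>3),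
       (a\<^sub>0,b\<^sub>1), (a\<^sub>1,b\<^sub>2), (a\<^sub>2,b\<^sub>3), (a\<^sub>1,b\<^sub>0), (a\<^sub>2,b\<^sub>1), (a\<^sub>3,b\<^sub>2)})"

definition F14 :: "(nat, nat \<times> nat) pre_digraph" where
  "F14 = (let a\<^sub>0 = 0; a\<^sub>1 = 1; a\<^sub>2 = 2; a\<^sub>3 = 3; c = 4; d = 5; e = 6; f = 7 in
    sgraph {a\<^sub>0, a\<^sub>1, a\<^sub>2, a\<^sub>3, c, d, e, f}
      {(a\<^sub>0,a\<^sub>1), (a\<^sub>1,a\<^sub>2), (a\<^sub>2,a\<^sub>3), (e,f), (c,d), (a\<^sub>0,e), (a\<^sub>3,f), (a\<^sub>0,c),
       (a\<^sub>1,d), (a\<^sub>2,c), (a\<^sub>3,d), (c,e), (d,f), (a\<^sub>1,e), (a\<^sub>2,f)})"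

definition F15 :: "(nat, nat \<times> nat) pre_digraph" where
  "F15 = (let a = 0; b = 1; c = 2; d = 3; e = 4; f = 5; g = 6; h = 7 in
    sgraph {a, b, c, d, e, f, g, h}
      {(a,b), (g,h), (c,d), (e,f), (a,g), (b,h), (c,f), (d,e),
       (a,e), (d,h), (c,g), (b,f), (a,c), (f,h), (e,g), (b,d)})"

definition F16 :: "(nat, nat \<times> nat) pre_digraph" where
  "F16 = (let p = 0; q = 1; l = 2; r = 3; m = 4; n = 5 in
    sgraph {p, q, l, r, m, n}
      {(p,q), (m,n), (q,r), (p,l), (m,r), (m,l), (n,r), (n,l)})"

definition F17 :: "(nat, nat \<times> nat) pre_digraph" where
  "F17 = (let p = 0; q = 1; l = 2; r = 3; m = 4; n = 5 in
    sgraph {p, q, l, r, m, n}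
      {(p,q), (m,n), (q,r), (p,l), (m,r), (m,l), (n,r), (n,l),
       (m,q)})"

definition F18 :: "(nat, nat \<times> nat) pre_digraph" where
  "F18 = (let p = 0; q = 1; s = 2; t = 3; l = 4; m = 5; r = 6; n = 7 in
    sgraph {p, q, s, t, l, m, r, n}
      {(p,q), (q,r), (p,l), (n,r), (n,l), (p,s), (q,t), (s,r),
       (t,l), (s,m), (t,m), (s,l), (t,r)})"

definition F19 :: "(nat, nat \<times> nat) pre_digraph" where
  "F19 = (let p = 0; q = 1; c = 2; d = 3; l = 4; r = 5; m = 6; n = 7 in
    sgraph {p, q, c, d, l, r, m, n}
      {(p,q), (c,d), (p,c), (q,d), (p,l), (q,r), (c,m), (d,m),
       (c,n), (d,n), (l,m), (r,m), (l,n), (r,n)})"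

definition F20 :: "(nat, nat \<times> nat) pre_digraph" where
  "F20 = (let p = 0; q = 1; s = 2; t = 3; l = 4; m = 5; r = 6; n = 7 in
    sgraph {p, q, s, t, l, m, r, n}
      {(p,q), (s,t), (q,r), (p,l), (s,q), (n,r), (p,t), (l,n),
       (l,m), (m,r), (s,l), (t,r), (s,m), (t,n)})"

definition F21 :: "(nat, nat \<times> nat) pre_digraph" where
  "F21 = (let p = 0; q = 1; s = 2; t = 3; l = 4; m = 5; r = 6; n = 7 in
    sgraph {p, q, s, t, l, m, r, n}
      {(p,q), (s,t), (q,r), (p,l), (s,q), (n,r), (p,t), (l,n),
       (l,m), (m,r), (s,l), (t,r), (s,m), (t,n), (p,m)})"

definition F22 :: "(nat, nat \<times> nat) pre_digraph" where
  "F22 = (let p = 0; q = 1; a = 2; b = 3; c = 4; d = 5; m = 6; n = 7 in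
    sgraph {p, q, a, b, c, d, m, n}
      {(p,q), (a,b), (b,c), (c,d), (m,n), (q,d), (p,a), (n,d),
       (n,a), (p,c), (q,b), (p,m), (q,m), (b,n), (c,n)})"

definition forbidden_graphs :: "(nat, nat \<times> nat) pre_digraph set" where
  "forbidden_graphs = {F1, F2, F3, F4, F5, F6, F7, F8, F9, F10, F11,
    F12, F13, F14, F15, F16, F17, F18, F19, F20, F21, F22}"

lemma graph_sgraph:
  assumes "finite V" "E \<subseteq> V \<times> V" "\<And>v. (v, v) \<notin> E"
  shows "graph (sgraph V E)"
proof -
  let ?G = "\<lparr> pverts = V, parcs = E \<union> E\<inverse> \<rparr>"
  have "finite E" using assms by (meson finite_SigmaI finite_subset)
  then have "pair_graph ?G"
    using assms by unfold_locales (auto simp: symmetric_def sym_def)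
  then show ?thesis unfolding sgraph_def by (rule pair_graph.pair_graphD_graph)
qed

lemma union_sgraph: "union (sgraph V E) (sgraph W F) = sgraph (V \<union> W) (E \<union> F)"
  unfolding union_def sgraph_def with_proj_def by auto

lemma graph_forbidden_graphs:
  assumes "F \<in> forbidden_graphs"
  shows "graph F"
proof -
  have "\<forall>F \<in> forbidden_graphs. graph F"
    unfolding forbidden_graphs_def ball_simps
      F1_def F2_def F3_def F4_def F5_def F6_def F7_def F8_def F9_def F10_def F11_def
      F12_def F13_def F14_def F15_def F16_def F17_def F18_def F19_def F20_def F21_def F22_def
      path_on_def diamond_def Let_def union_sgraph
    by (intro conjI TrueI; rule graph_sgraph; auto)
  with assms show ?thesis by blast
qed

end

theory Submission
  imports Defs
begin

text \<open>
  The degree bound behind the theorem is purely structural: if all cliques of a graph of this class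
  have at most \<open>k\<close> vertices, then at most \<open>k\<close> vertices have degree at least \<open>k\<close>. A b-coloring with
  \<open>k + 1 > \<chi>\<close> colors has \<open>k + 1\<close> b-vertices, all of degree at least \<open>k\<close>, and so contradicts the
  bound.

  The bound is proved by induction on the number of vertices. If the vertices of degree at least \<open>k\<close>
  form a clique, it is trivial. Otherwise two of them, \<open>u\<close> and \<open>v\<close>, are nonadjacent. Both have a
  neighbourhood that is not a clique, and \<open>P\<^sub>5\<close>, \<open>F\<^sub>2\<close>, \<open>F\<^sub>4\<close>, \<open>F\<^sub>5\<close>, \<open>F\<^sub>8\<close> then force, for
  one of them, say \<open>u\<close>, that the neighbours \<open>D\<close> of \<open>u\<close> which dominate \<open>u\<close> separate
  \<open>P = N[u] - D\<close> from the rest \<open>Y\<close>. As \<open>D\<close> is a clique complete to \<open>P\<close>, and \<open>P\<close> contains a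
  \<open>P\<^sub>3\<close>, the remaining forbidden graphs restrict \<open>Y\<close> so much that the vertices of high degree
  in \<open>P\<close>, \<open>D\<close> and \<open>Y\<close> can be counted separately. Chordality enters only through the absence of
  induced cycles of length 4 and 5.
\<close>

section \<open>Vertices of high degree\<close>

definition clique :: "('a \<Rightarrow> 'a \<Rightarrow> bool) \<Rightarrow> 'a set \<Rightarrow> bool" where
  "clique E Q \<longleftrightarrow> (\<forall>x\<in>Q. \<forall>y\<in>Q. x \<noteq> y \<longrightarrow> E x y)"

definition nbrs :: "('a \<Rightarrow> 'a \<Rightarrow> bool) \<Rightarrow> 'a set \<Rightarrow> 'a \<Rightarrow> 'a set" where
  "nbrs E V x = {y \<in> V. E x y}"

definition anti :: "('a \<Rightarrow> 'a \<Rightarrow> bool) \<Rightarrow> 'a set \<Rightarrow> 'a set \<Rightarrow> bool" where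
  "anti E X Y \<longleftrightarrow> (\<forall>x\<in>X. \<forall>y\<in>Y. \<not> E x y)"

definition full :: "('a \<Rightarrow> 'a \<Rightarrow> bool) \<Rightarrow> 'a set \<Rightarrow> 'a set \<Rightarrow> bool" where
  "full E X Y \<longleftrightarrow> (\<forall>x\<in>X. \<forall>y\<in>Y. E x y)"

definition P3 :: "('a \<Rightarrow> 'a \<Rightarrow> bool) \<Rightarrow> 'a \<Rightarrow> 'a \<Rightarrow> 'a \<Rightarrow> bool" where
  "P3 E a b c \<longleftrightarrow> E a b \<and> E b c \<and> \<not> E a c \<and> a \<noteq> c"

definition P4 :: "('a \<Rightarrow> 'a \<Rightarrow> bool) \<Rightarrow> 'a \<Rightarrow> 'a \<Rightarrow> 'a \<Rightarrow> 'a \<Rightarrow> bool" where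
  "P4 E a b c d \<longleftrightarrow> E a b \<and> E b c \<and> E c d \<and> \<not> E a c \<and> \<not> E a d \<and> \<not> E b d"

definition K3 :: "('a \<Rightarrow> 'a \<Rightarrow> bool) \<Rightarrow> 'a \<Rightarrow> 'a \<Rightarrow> 'a \<Rightarrow> bool" where
  "K3 E a b c \<longleftrightarrow> E a b \<and> E a c \<and> E b c"

definition is_diamond :: "('a \<Rightarrow> 'a \<Rightarrow> bool) \<Rightarrow> 'a \<Rightarrow> 'a \<Rightarrow> 'a \<Rightarrow> 'a \<Rightarrow> bool" where
  "is_diamond E a b c d \<longleftrightarrow> E a b \<and> E a c \<and> E a d \<and> E b c \<and> E b d \<and> \<not> E c d \<and> c \<noteq> d"

lemmas config_defs = anti_def full_def P3_def P4_def K3_def is_diamond_def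

text \<open>
  Distinctness is assumed only for vertices that adjacency to the other vertices of the pattern
  does not already distinguish.
\<close>

locale free_graph =
  fixes E :: "'a \<Rightarrow> 'a \<Rightarrow> bool"
  assumes sym: "E x y \<Longrightarrow> E y x"
    and irrefl: "\<not> E x x"
    and no_C4: "E a b \<Longrightarrow> E b c \<Longrightarrow> E c d \<Longrightarrow> E d a \<Longrightarrow> \<not> E a c \<Longrightarrow> \<not> E b d \<Longrightarrow> a \<noteq> c \<Longrightarrow> b \<noteq> d \<Longrightarrow> False"
    and no_C5: "P4 E a b c d \<Longrightarrow> E d e \<Longrightarrow> E e a \<Longrightarrow> \<not> E b e \<Longrightarrow> \<not> E c e \<Longrightarrow> False"
    and no_P5: "P4 E a b c d \<Longrightarrow> E d e \<Longrightarrow> anti E {a, b, c} {e} \<Longrightarrow> False"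
    and no_F2: "P4 E a b c d \<Longrightarrow> P3 E e f g \<Longrightarrow> anti E {a, b, c, d} {e, f, g} \<Longrightarrow> False"
    and no_F3: "P3 E a b c \<Longrightarrow> P3 E d e f \<Longrightarrow> P3 E g h i \<Longrightarrow> anti E {a, b, c} {d, e, f, g, h, i} \<Longrightarrow>
      anti E {d, e, f} {g, h, i} \<Longrightarrow> False"
    and no_F4: "K3 E a b c \<Longrightarrow> K3 E b c d \<Longrightarrow> K3 E c d e \<Longrightarrow> K3 E d e f \<Longrightarrow>
      anti E {a} {d, e, f} \<Longrightarrow> anti E {b} {e, f} \<Longrightarrow> \<not> E c f \<Longrightarrow> False"
    and no_F5: "is_diamond E p s l m \<Longrightarrow> is_diamond E m r q t \<Longrightarrow> anti E {l, p, s} {q, r, t} \<Longrightarrow> False"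
    and no_F6: "is_diamond E a b c d \<Longrightarrow> is_diamond E e f g h \<Longrightarrow> anti E {a, b, c, d} {e, f, g, h} \<Longrightarrow> False"
    and no_F7: "is_diamond E a b c d \<Longrightarrow> is_diamond E e f g h \<Longrightarrow> E a e \<Longrightarrow> anti E {b, c, d} {e, f, g, h} \<Longrightarrow>
      anti E {a} {f, g, h} \<Longrightarrow> False"
    and no_F8: "P4 E a b c d \<Longrightarrow> K3 E w x y \<Longrightarrow> full E {v} {a, b, c, d, w} \<Longrightarrow> anti E {v} {x, y} \<Longrightarrow>
      anti E {a, b, c, d} {w, x, y} \<Longrightarrow> False"
    and no_F9: "P3 E a b c \<Longrightarrow> P3 E d e f \<Longrightarrow> K3 E w x y \<Longrightarrow> full E {v} {a, b, c, d, e, f, w} \<Longrightarrow>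
      anti E {v} {x, y} \<Longrightarrow> anti E {a, b, c} {d, e, f, w, x, y} \<Longrightarrow> anti E {d, e, f} {w, x, y} \<Longrightarrow> False"
begin

lemma adj_commute: "E x y \<longleftrightarrow> E y x"
  using sym by blast

lemma nbrs_iff [simp]: "y \<in> nbrs E V x \<longleftrightarrow> y \<in> V \<and> E x y"
  by (simp add: nbrs_def)

lemma clique_insert: "clique E (insert x Q) \<longleftrightarrow> clique E Q \<and> (\<forall>y\<in>Q. x \<noteq> y \<longrightarrow> E x y)"
proof
  assume "clique E (insert x Q)"
  then show "clique E Q \<and> (\<forall>y\<in>Q. x \<noteq> y \<longrightarrow> E x y)" by (simp add: clique_def)
next
  assume "clique E Q \<and> (\<forall>y\<in>Q. x \<noteq> y \<longrightarrow> E x y)"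
  then show "clique E (insert x Q)" by (auto simp: clique_def intro: sym)
qed

section \<open>Private and common neighbours of two nonadjacent vertices\<close>

lemma private_anti:
  assumes "u \<noteq> v" "\<not> E u v" "E u a" "\<not> E v a" "E u a'" "\<not> E v a'" "a \<noteq> a'" "\<not> E a a'"
    and "E v c" "\<not> E u c"
  shows "\<not> E a c"
proof
  assume "E a c"
  show False
  \<comment> \<open>With \<open>E a' c\<close> the vertices \<open>u\<close>, \<open>a\<close>,
    \<open>c\<close>, \<open>a'\<close> induce a 4-cycle; without it \<open>a'\<close>,
    \<open>u\<close>, \<open>a\<close>, \<open>c\<close>, \<open>v\<close> induce a P5.\<close>
  proof (cases "E a' c")
    case True
    then show False using no_C4[of u a c a'] assms \<open>E a c\<close> by (auto simp: adj_commute)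
  next
    case False
    then show False using no_P5[of a' u a c v] assms \<open>E a c\<close>
      by (auto simp: config_defs adj_commute)
  qed
qed

text \<open>The only possible chords of the 5-cycle \<open>u\<close>, \<open>a\<close>,
  \<open>c\<close>, \<open>v\<close>, \<open>w\<close> are \<open>a w\<close> and
  \<open>c w\<close>. If either is missing, an induced cycle of length 4 or 5 remains.\<close>

lemma common_full:
  assumes "u \<noteq> v" "\<not> E u v" "E u a" "\<not> E v a" "E v c" "\<not> E u c" "E a c" "E u w" "E v w"
  shows "E a w" "E c w"
proof -
  show "E a w"
  proof (rule ccontr)
    assume n: "\<not> E a w"
    show False
    proof (cases "E c w")
      case True
      moreover have "u \<noteq> c" "a \<noteq> w" using assms sym by blast+
      ultimately show False using no_C4[of u a c w] assms n by (auto simp: adj_commute)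
    next
      case False
      then show False using no_C5[of u a c v w] assms n by (auto simp: config_defs adj_commute)
    qed
  qed
  moreover have "a \<noteq> v" "c \<noteq> w" using assms sym by blast+
  ultimately show "E c w"
    using no_C4[of a c v w] assms by (auto simp: adj_commute)
qed

text \<open>If both sides failed, the two failures would combine to the triangle strip
  \<open>a\<close>, \<open>u\<close>, \<open>w'\<close>, \<open>w\<close>, \<open>v\<close>,
  \<open>c\<close>, which is \<open>F4\<close>.\<close>

lemma common_full_one_side:
  assumes "u \<noteq> v" "\<not> E u v" 
  shows "(\<forall>w a. E u w \<and> E v w \<and> E u a \<and> \<not> E v a \<longrightarrow> E a w) \<or>
    (\<forall>w c. E u w \<and> E v w \<and> E v c \<and> \<not> E u c \<longrightarrow> E c w)"
proof (rule ccontr)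
  assume "\<not> ?thesis"
  then obtain w a w' c where w: "E u w" "E v w" "E u a" "\<not> E v a" "\<not> E a w"
    and w': "E u w'" "E v w'" "E v c" "\<not> E u c" "\<not> E c w'" by blast
  have ac: "\<not> E a c" using common_full(1)[of u v a c w] assms w w' by blast
  \<comment> \<open>A common neighbour seeing neither \<open>a\<close> nor \<open>c\<close> would be
    the middle of a P5 from \<open>a\<close> to \<open>c\<close>.\<close>
  have one: "E a x \<or> E c x" if "E u x" "E v x" for x
    using no_P5[of a u x v c] that w w' ac assms by (auto simp: config_defs adj_commute)
  have "E c w" "E a w'" using one w w' by blast+
  moreover have "E w w'"
    using no_C4[of u w v w'] w w' assms \<open>E c w\<close> by (auto simp: adj_commute)
  ultimately show False
    using no_F4[of a u w' w v c] w w' ac assms by (auto simp: config_defs adj_commute)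
qed

text \<open>If \<open>u\<close> missed \<open>o'\<close>, then \<open>o'\<close>, \<open>a\<close>,
  \<open>u\<close>, \<open>a'\<close> would induce a \<open>P4\<close> anticomplete to the
  \<open>P3\<close> on \<open>c\<close>, \<open>v\<close>, \<open>c'\<close>, which is
  \<open>F2\<close>.\<close>

lemma private_closed_P3:
  assumes "u \<noteq> v" "\<not> E u v" "E u a" "\<not> E v a" "E u a'" "\<not> E v a'" "a \<noteq> a'" "\<not> E a a'"
    and "E v c" "\<not> E u c" "E v c'" "\<not> E u c'" "c \<noteq> c'" "\<not> E c c'"
    and o: "E a o'" "o' \<noteq> u"
  shows "E u o'"
proof (rule ccontr)
  assume n: "\<not> E u o'"
  have ac: "\<not> E a c" "\<not> E a c'" "\<not> E a' c" "\<not> E a' c'"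
    using private_anti[of u v] assms by (metis adj_commute)+
  have oa': "\<not> E a' o'"
    using no_C4[of o' a u a'] n assms by (auto simp: adj_commute)
  have "\<not> E o' c" "\<not> E o' c'" "\<not> E o' v"
    using no_P5[of a' u a o' c] no_P5[of a' u a o' c'] no_P5[of a' u a o' v] n oa' ac assms
    by (auto simp: config_defs adj_commute)
  then show False
    using no_F2[of o' a u a' c v c'] n oa' ac assms by (auto simp: config_defs adj_commute)
qed

text \<open>Here the private neighbours of \<open>v\<close> offer only an edge \<open>c c'\<close>,
  so the \<open>P3\<close> around \<open>v\<close> is replaced by the triangle \<open>v\<close>,
  \<open>c\<close>, \<open>c'\<close>, attached through \<open>w\<close>. If \<open>u\<close> missed
  \<open>o'\<close>, then \<open>w\<close> would be complete to the \<open>P4\<close> on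
  \<open>o'\<close>, \<open>a\<close>, \<open>u\<close>, \<open>a'\<close>, which gives
  \<open>F8\<close>.\<close>

lemma private_closed_edge:
  assumes "u \<noteq> v" "\<not> E u v" "E u a" "\<not> E v a" "E u a'" "\<not> E v a'" "a \<noteq> a'" "\<not> E a a'"
    and w: "E u w" "E v w" "E a w" "E a' w"
    and c: "E v c" "\<not> E u c" "\<not> E c w" "E v c'" "\<not> E u c'" "E c c'"
    and o: "E a o'" "o' \<noteq> u"
  shows "E u o'"
proof (rule ccontr)
  assume n: "\<not> E u o'"
  have ac: "\<not> E a c" "\<not> E a c'" "\<not> E a' c" "\<not> E a' c'"
    using private_anti[of u v] assms by (metis adj_commute)+
  \<comment> \<open>Otherwise the diamonds on \<open>v\<close>, \<open>c'\<close>, \<open>c\<close>,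
    \<open>w\<close> and on \<open>w\<close>, \<open>u\<close>, \<open>a\<close>, \<open>a'\<close>
    share just \<open>w\<close> and form \<open>F5\<close>.\<close>
  have wc': "\<not> E c' w"
    using no_F5[of v c' c w u a a'] ac assms by (auto simp: config_defs adj_commute)
  have oa': "\<not> E a' o'"
    using no_C4[of o' a u a'] n assms by (auto simp: adj_commute)
  \<comment> \<open>Otherwise the path \<open>o'\<close>, \<open>a\<close>, \<open>w\<close>,
    \<open>v\<close> closes to an induced 4-cycle, or extends by \<open>c\<close> to an induced
    5-cycle or a P5.\<close>
  have ow: "E o' w"
  proof (rule ccontr)
    assume ow: "\<not> E o' w"
    have ov: "\<not> E o' v"
    proof -
      have "o' \<noteq> w" "a \<noteq> v" using assms n by auto
      then show ?thesis using no_C4[of o' a w v] n ow assms by (auto simp: adj_commute)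
    qed
    show False
    proof (cases "E o' c")
      case True
      then show False using no_C5[of o' a w v c] n ow ov ac assms
        by (auto simp: config_defs adj_commute)
    next
      case False
      then show False using no_P5[of o' a w v c] n ow ov ac assms
        by (auto simp: config_defs adj_commute)
    qed
  qed
  have "\<not> E o' c" "\<not> E o' c'" "\<not> E o' v"
    using no_P5[of a' u a o' c] no_P5[of a' u a o' c'] no_P5[of a' u a o' v] n oa' ac assms
    by (auto simp: config_defs adj_commute)
  then show False
    using no_F8[of o' a u a' v c c' w] n oa' ac ow wc' assms by (auto simp: config_defs adj_commute)
qed

section \<open>Centres of \<open>P3\<close>s in the absence of \<open>P4\<close> and of two
  anticomplete \<open>P3\<close>s\<close>

definition centre :: "'a set \<Rightarrow> 'a \<Rightarrow> bool" where
  "centre H s \<longleftrightarrow> s \<in> H \<and> (\<exists>x\<in>H. \<exists>y\<in>H. P3 E x s y)"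

definition P4_free :: "'a set \<Rightarrow> bool" where
  "P4_free H \<longleftrightarrow> (\<forall>a\<in>H. \<forall>b\<in>H. \<forall>c\<in>H. \<forall>d\<in>H. \<not> P4 E a b c d)"

definition two_P3_free :: "'a set \<Rightarrow> bool" where
  "two_P3_free H \<longleftrightarrow> (\<forall>a\<in>H. \<forall>b\<in>H. \<forall>c\<in>H. \<forall>d\<in>H. \<forall>e\<in>H. \<forall>f\<in>H.
     P3 E a b c \<longrightarrow> P3 E d e f \<longrightarrow> \<not> anti E {a, b, c} {d, e, f})"

text \<open>Between the \<open>P3\<close>s around two nonadjacent centres, any edge would create a
  \<open>P4\<close> or an induced 4-cycle, so these \<open>P3\<close>s would be
  anticomplete.\<close>

lemma centres_adj:
  assumes "P4_free H" "two_P3_free H" "centre H s" "centre H t" "s \<noteq> t"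
  shows "E s t"
proof (rule ccontr)
  assume n: "\<not> E s t"
  have far: "\<not> E x t'" if "x \<in> H" "x' \<in> H" "s' \<in> H" "t' \<in> H" "P3 E x s' x'" "s' \<noteq> t'" "\<not> E s' t'" for x x' s' t'
  proof
    assume xt: "E x t'"
    have "\<not> E x' t'"
      using no_C4[of s' x t' x'] that xt by (auto simp: P3_def adj_commute)
    then have "P4 E x' s' x t'" using that xt by (auto simp: config_defs adj_commute)
    then show False using assms(1) that by (auto simp: P4_free_def)
  qed
  obtain x x' where x: "x \<in> H" "x' \<in> H" "P3 E x s x'" "s \<in> H" using assms(3) by (auto simp: centre_def)
  obtain y y' where y: "y \<in> H" "y' \<in> H" "P3 E y t y'" "t \<in> H" using assms(4) by (auto simp: centre_def)
  have rev: "P3 E x' s x" "P3 E y' t y" using x y by (auto simp: P3_def adj_commute)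
  have 1: "\<not> E x t" "\<not> E x' t" "\<not> E y s" "\<not> E y' s"
    using far[of x x' s t] far[of x' x s t] far[of y y' t s] far[of y' y t s] x y rev n assms(5)
    by (auto simp: adj_commute)
  have "\<not> E a b" if "a \<in> {x, x'}" "b \<in> {y, y'}" for a b
  proof
    assume "E a b"
    then have "P4 E s a b t" using that x y 1 n by (auto simp: config_defs adj_commute)
    then show False using assms(1) that x y by (auto simp: P4_free_def)
  qed
  then have "anti E {x, s, x'} {y, t, y'}" using 1 n by (auto simp: anti_def adj_commute)
  then show False using assms(2) x y by (auto simp: two_P3_free_def)
qed

text \<open>A private neighbour \<open>x\<close> of \<open>s\<close> and a private neighbour
  \<open>y\<close> of \<open>t\<close> would give an induced 4-cycle if adjacent and a
  \<open>P4\<close> otherwise.\<close>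

lemma nested:
  assumes "P4_free H" "s \<in> H" "t \<in> H" "E s t"
  shows "(\<forall>x\<in>H. E s x \<longrightarrow> x \<noteq> t \<longrightarrow> E t x) \<or> (\<forall>x\<in>H. E t x \<longrightarrow> x \<noteq> s \<longrightarrow> E s x)"
proof (rule ccontr)
  assume "\<not> ?thesis"
  then obtain x y where xy: "x \<in> H" "E s x" "x \<noteq> t" "\<not> E t x" "y \<in> H" "E t y" "y \<noteq> s" "\<not> E s y"
    by blast
  have "\<not> E x y"
    using no_C4[of x s t y] xy assms(4) by (auto simp: adj_commute)
  then have "P4 E x s t y" using xy assms(4) by (auto simp: config_defs adj_commute)
  then show False using assms xy by (auto simp: P4_free_def)
qed

text \<open>By \<open>nested\<close>, all further neighbours of one centre are seen by the other
  one; the ends of a \<open>P3\<close> around the former complete the diamond.\<close>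

lemma two_centres_diamond:
  assumes "P4_free H" "two_P3_free H" "centre H s" "centre H t" "s \<noteq> t"
  shows "\<exists>x\<in>H. \<exists>y\<in>H. is_diamond E s t x y"
proof -
  have st: "E s t" using centres_adj assms by blast
  have *: "\<exists>x\<in>H. \<exists>y\<in>H. is_diamond E s' t' x y"
    if c: "centre H s'" and "E s' t'" and n: "\<forall>x\<in>H. E s' x \<longrightarrow> x \<noteq> t' \<longrightarrow> E t' x" for s' t'
  proof -
    obtain x y where xy: "x \<in> H" "y \<in> H" "P3 E x s' y" using c by (auto simp: centre_def)
    have "x \<noteq> t'" "y \<noteq> t'" using n xy by (auto simp: P3_def adj_commute)
    then show ?thesis using n xy \<open>E s' t'\<close> by (intro bexI[of _ x] bexI[of _ y]) (auto simp: config_defs adj_commute)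
  qed
  have sw: "is_diamond E t s x y \<Longrightarrow> is_diamond E s t x y" for x y by (auto simp: is_diamond_def adj_commute)
  show ?thesis
    using nested[OF assms(1) _ _ st] *[of s t] *[of t s] assms st sw sym unfolding centre_def by metis
qed

text \<open>A centre of least degree works: closed neighbourhoods of centres are comparable, so
  every other centre sees what this one sees.\<close>

lemma min_centre:
  assumes "finite H" "P4_free H" "two_P3_free H" "centre H c"
  obtains s x x' where "centre H s" "x \<in> H" "x' \<in> H" "P3 E x s x'"
    "\<And>t y. centre H t \<Longrightarrow> y \<in> H \<Longrightarrow> E s y \<Longrightarrow> y \<noteq> t \<Longrightarrow> E t y"
proof -
  obtain s where s: "centre H s" and min: "\<And>t. centre H t \<Longrightarrow> card (nbrs E H s) \<le> card (nbrs E H t)"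
    using ex_has_least_nat[of "centre H" c "\<lambda>s. card (nbrs E H s)"] assms(4) by blast
  have sH: "s \<in> H" using s by (simp add: centre_def)
  have "E t y" if t: "centre H t" and y: "y \<in> H" "E s y" "y \<noteq> t" for t y
  proof (cases "s = t")
    case False
    have tH: "t \<in> H" using t by (simp add: centre_def)
    have st: "E s t" using centres_adj assms s t False by blast
    have fin: "finite (nbrs E H s)" "finite (nbrs E H t)" using assms(1) by (auto simp: nbrs_def)
    show ?thesis
    proof (rule ccontr)
      assume n: "\<not> E t y"
      \<comment> \<open>Since \<open>t\<close> misses \<open>y\<close>, the nesting can only go from
        \<open>t\<close> to \<open>s\<close>; minimality of \<open>s\<close> then forces
        equality.\<close>
      then have sub: "insert t (nbrs E H t) \<subseteq> insert s (nbrs E H s)"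
        using nested[OF assms(2) sH tH st] y st tH by auto
      have "card (insert s (nbrs E H s)) \<le> card (insert t (nbrs E H t))"
        using min[OF t] fin irrefl by simp
      then have "insert t (nbrs E H t) = insert s (nbrs E H s)"
        using sub fin card_seteq by (metis finite_insert)
      then have "y \<in> insert t (nbrs E H t)" using y by simp
      then show False using n y by auto
    qed
  qed (use that in simp)
  moreover obtain x x' where "x \<in> H" "x' \<in> H" "P3 E x s x'" using s by (auto simp: centre_def)
  ultimately show thesis using that s by blast
qed

text \<open>The ends of a \<open>P3\<close> around a least centre see all other centres and, being
  nonadjacent, are not both centres themselves. The extra vertex \<open>x\<close> supplies the
  \<open>+ 1\<close> in the later counts.\<close>

lemma centres_clique:
  assumes "finite H" "P4_free H" "two_P3_free H" "centre H c"
  obtains x where "x \<in> H" "\<not> centre H x" "clique E (insert x {s. centre H s})"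
proof -
  obtain s x x' where s: "centre H s" "x \<in> H" "x' \<in> H" "P3 E x s x'"
    and top: "\<And>t y. centre H t \<Longrightarrow> y \<in> H \<Longrightarrow> E s y \<Longrightarrow> y \<noteq> t \<Longrightarrow> E t y"
    using min_centre[OF assms] by metis
  have "\<not> centre H x \<or> \<not> centre H x'"
    using centres_adj[OF assms(2,3), of x x'] s(4) by (auto simp: P3_def)
  then obtain z where z: "z \<in> H" "\<not> centre H z" "E s z"
    using s by (auto simp: P3_def adj_commute)
  have "clique E (insert z {s. centre H s})"
    using centres_adj[OF assms(2,3)] top z unfolding clique_def
    by (metis adj_commute insertE mem_Collect_eq)
  then show thesis using z that by blast
qed

end

section \<open>Restrictions on the two sides of a clique cutset\<close>

locale clique_cutset = free_graph +
  fixes P D Y :: "'a set" and p u p' :: 'a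
  assumes D_clique: "clique E D" and PD: "full E P D" and PY: "anti E P Y"
    and P3: "P3 E p u p'" and in_P: "p \<in> P" "u \<in> P" "p' \<in> P"
begin

lemma PD': "x \<in> P \<Longrightarrow> d \<in> D \<Longrightarrow> E x d" "x \<in> P \<Longrightarrow> d \<in> D \<Longrightarrow> E d x"
  using PD sym by (auto simp: full_def)

lemma PY': "x \<in> P \<Longrightarrow> y \<in> Y \<Longrightarrow> \<not> E x y" "x \<in> P \<Longrightarrow> y \<in> Y \<Longrightarrow> \<not> E y x"
  using PY sym by (auto simp: anti_def)

lemmas pd = PD'[OF in_P(1)] PD'[OF in_P(2)] PD'[OF in_P(3)]
lemmas py = PY'[OF in_P(1)] PY'[OF in_P(2)] PY'[OF in_P(3)]

text \<open>Otherwise the triangle and \<open>d\<close> form a diamond that shares \<open>d\<close>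
  with the diamond on \<open>d\<close>, \<open>u\<close>, \<open>p\<close>, \<open>p'\<close>,
  giving \<open>F5\<close>. Thus \<open>d\<close> sees zero, one or three vertices of any triangle
  in \<open>Y\<close>.\<close>

lemma triangle_two:
  assumes "d \<in> D" "w \<in> Y" "w' \<in> Y" "t \<in> Y" "K3 E w w' t" "E d w" "E d w'"
  shows "E d t"
proof (rule ccontr)
  assume n: "\<not> E d t"
  show False
    using no_F5[of w w' t d u p p'] n assms P3 pd py by (auto simp: config_defs adj_commute)
qed

text \<open>The vertices \<open>d\<close>, \<open>u\<close>, \<open>p\<close>, \<open>p'\<close>
  form a diamond in which \<open>d\<close> has degree 3. The partial adjacencies of \<open>d\<close>
  that \<open>triangle_two\<close> leaves open give \<open>F6\<close>, \<open>F7\<close>, P5 or an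
  induced 4-cycle.\<close>

lemma diamond_full:
  assumes "d \<in> D" "is_diamond E w w' t t'" "w \<in> Y" "w' \<in> Y" "t \<in> Y" "t' \<in> Y"
  shows "E d w" "E d w'" "E d t" "E d t'"
proof -
  have k3: "K3 E w w' t" "K3 E w w' t'" "K3 E w t w'" "K3 E w t' w'" "K3 E w' t w" "K3 E w' t' w"
    using assms(2) by (auto simp: config_defs adj_commute)
  note two = triangle_two[OF assms(1)]
  have "E d w \<and> E d w'"
  proof (rule ccontr)
    assume "\<not> ?thesis"
    then consider "\<not> E d w" "\<not> E d w'" "\<not> E d t" "\<not> E d t'"
      | "E d w" "\<not> E d w'" "\<not> E d t" "\<not> E d t'"
      | "\<not> E d w" "E d w'" "\<not> E d t" "\<not> E d t'"
      | "\<not> E d w" "\<not> E d w'" "E d t" "\<not> E d t'"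
      | "\<not> E d w" "\<not> E d w'" "\<not> E d t" "E d t'"
      | "\<not> E d w" "\<not> E d w'" "E d t" "E d t'"
      using two k3 assms(3-6) by metis
    then show False
    proof cases
      case 1
      then show False
        using no_F6[of d u p p' w w' t t'] assms P3 pd py by (auto simp: config_defs adj_commute)
    next
      case 2
      then show False
        using no_F7[of d u p p' w w' t t'] assms P3 pd py by (auto simp: config_defs adj_commute)
    next
      case 3
      then show False
        using no_F7[of d u p p' w' w t t'] assms P3 pd py by (auto simp: config_defs adj_commute)
    next
      case 4
      then show False
        using no_P5[of p d t w t'] assms P3 pd py by (auto simp: config_defs adj_commute)
    next
      case 5
      then show False
        using no_P5[of p d t' w t] assms P3 pd py by (auto simp: config_defs adj_commute)
    next
      case 6
      moreover have "d \<noteq> w" using PY'[OF in_P(1)] PD'[OF in_P(1)] assms by blast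
      ultimately show False
        using no_C4[of d t w t'] assms by (auto simp: config_defs adj_commute)
    qed
  qed
  then show "E d w" "E d w'" "E d t" "E d t'" using two k3 assms by blast+
qed

text \<open>
  A vertex \<open>x\<close> of high degree in \<open>Y\<close> is the centre of a \<open>P\<^sub>3\<close> in \<open>Y\<close> or, by \<open>F\<^sub>5\<close>,
  lies in a clique of \<open>Y\<close> in which some \<open>d\<close> in \<open>D\<close> sees \<open>x\<close> only. The latter happens for at
  most one \<open>x\<close>, and only if \<open>Y\<close> has no \<open>P\<^sub>3\<close>.
\<close>

definition pendant :: "'a \<Rightarrow> 'a \<Rightarrow> 'a \<Rightarrow> 'a \<Rightarrow> bool" where
  "pendant d x y z \<longleftrightarrow> d \<in> D \<and> x \<in> Y \<and> y \<in> Y \<and> z \<in> Y \<and> K3 E x y z \<and> E d x \<and>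
     (\<forall>w\<in>Y. E x w \<longrightarrow> \<not> E d w) \<and> clique E (nbrs E Y x)"

text \<open>As \<open>d\<close> is complete to \<open>P\<close> and sees only \<open>x\<close> in
  the triangle, a \<open>P4\<close> in \<open>P\<close> would complete \<open>F8\<close>.\<close>

lemma pendant_P4_free:
  assumes "pendant d x y z"
  shows "P4_free P"
  unfolding P4_free_def
proof (intro ballI notI)
  fix a b c e assume *: "a \<in> P" "b \<in> P" "c \<in> P" "e \<in> P" "P4 E a b c e"
  have "\<not> E d y" "\<not> E d z" using assms by (auto simp: pendant_def K3_def)
  then show False
    using no_F8[OF *(5), of x y z d] * PD' PY' assms by (auto simp: pendant_def full_def anti_def)
qed

text \<open>Two anticomplete \<open>P3\<close>s in \<open>P\<close>, joined through \<open>d\<close>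
  to the triangle, would form \<open>F9\<close>.\<close>

lemma pendant_two_P3_free:
  assumes "pendant d x y z"
  shows "two_P3_free P"
  unfolding two_P3_free_def
proof (intro ballI notI impI)
  fix a b c a' b' c' assume *: "a \<in> P" "b \<in> P" "c \<in> P" "a' \<in> P" "b' \<in> P" "c' \<in> P"
    "P3 E a b c" "P3 E a' b' c'" "anti E {a, b, c} {a', b', c'}"
  have "\<not> E d y" "\<not> E d z" using assms by (auto simp: pendant_def K3_def)
  then show False
    using no_F9[OF *(7,8), of x y z d] * PD' PY' assms by (auto simp: pendant_def full_def anti_def)
qed

text \<open>A \<open>P3\<close> on one side of the cutset excludes \<open>P4\<close> on the other by
  \<open>F2\<close> and two anticomplete \<open>P3\<close>s by \<open>F3\<close>. This lemma and the
  next three apply that in both directions.\<close>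

lemma P3_P4_free:
  assumes "P3 E a b c" "a \<in> Y" "b \<in> Y" "c \<in> Y"
  shows "P4_free P"
  unfolding P4_free_def
proof (intro ballI notI)
  fix w x y z assume *: "w \<in> P" "x \<in> P" "y \<in> P" "z \<in> P" "P4 E w x y z"
  show False
    using no_F2[OF *(5) assms(1)] * PY' assms by (auto simp: anti_def)
qed

lemma P3_two_P3_free:
  assumes "P3 E a b c" "a \<in> Y" "b \<in> Y" "c \<in> Y"
  shows "two_P3_free P"
  unfolding two_P3_free_def
proof (intro ballI notI impI)
  fix d e f d' e' f' assume *: "d \<in> P" "e \<in> P" "f \<in> P" "d' \<in> P" "e' \<in> P" "f' \<in> P"
    "P3 E d e f" "P3 E d' e' f'" "anti E {d, e, f} {d', e', f'}"
  show False
    using no_F3[OF *(7,8) assms(1)] * PY' assms by (auto simp: anti_def)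
qed

lemma Y_P4_free: "P4_free Y"
  unfolding P4_free_def
proof (intro ballI notI)
  fix w x y z assume *: "w \<in> Y" "x \<in> Y" "y \<in> Y" "z \<in> Y" "P4 E w x y z"
  show False
    using no_F2[OF *(5) P3] * py by (auto simp: anti_def)
qed

lemma Y_two_P3_free: "two_P3_free Y"
  unfolding two_P3_free_def
proof (intro ballI notI impI)
  fix d e f d' e' f' assume *: "d \<in> Y" "e \<in> Y" "f \<in> Y" "d' \<in> Y" "e' \<in> Y" "f' \<in> Y"
    "P3 E d e f" "P3 E d' e' f'" "anti E {d, e, f} {d', e', f'}"
  show False
    using no_F3[OF *(7,8) P3] * py by (auto simp: anti_def)
qed

text \<open>If \<open>x\<close> saw \<open>s\<close>, an induced 4-cycle or a P5 through
  \<open>d\<close> would force every other neighbour of \<open>s\<close> in \<open>Y\<close> to see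
  \<open>x\<close>. But \<open>x\<close> and its neighbours in \<open>Y\<close> form a clique, which
  cannot hold both \<open>a\<close> and \<open>b\<close>.\<close>

lemma pendant_centre:
  assumes "pendant d x y z" "P3 E a s b" "a \<in> Y" "s \<in> Y" "b \<in> Y"
  shows "\<not> E x s"
proof
  assume xs: "E x s"
  have ds: "\<not> E d s" "E d x" "d \<in> D" "x \<in> Y" using xs assms by (auto simp: pendant_def)
  have bad: False if b': "E s b'" "b' \<in> Y" "\<not> E x b'" "x \<noteq> b'" for b'
  proof -
    have "d \<noteq> s" using PY'[OF in_P(1)] PD'[OF in_P(1)] assms ds by blast
    then have "\<not> E d b'" using no_C4[of d x s b'] b' xs ds by (auto simp: adj_commute)
    then show False using no_P5[of p d x s b'] b' xs ds assms pd py by (auto simp: config_defs adj_commute)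
  qed
  have "a = x \<or> E x a" "b = x \<or> E x b" using bad assms by (auto simp: P3_def adj_commute)
  then show False using assms unfolding pendant_def clique_def P3_def
    by (metis adj_commute nbrs_iff)
qed

text \<open>The triangle at \<open>x\<close> turns out to be anticomplete to the \<open>P3\<close>.
  Then \<open>d\<close> can see neither all of the \<open>P3\<close> (\<open>F9\<close>), nor
  nothing of it (\<open>F2\<close>), nor only a part (P5 or an induced 4-cycle).\<close>

lemma pendant_no_P3:
  assumes q: "pendant d x y z" and abs: "P3 E a s b" "a \<in> Y" "s \<in> Y" "b \<in> Y"
  shows False
proof -
  have q': "d \<in> D" "x \<in> Y" "y \<in> Y" "z \<in> Y" "E x y" "E x z" "E y z" "E d x" "\<not> E d y" "\<not> E d z"
    using q by (auto simp: pendant_def K3_def)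
  have cl: "E v w" if "v \<in> Y" "w \<in> Y" "E x v" "E x w" "v \<noteq> w" for v w
    using q that by (auto simp: pendant_def clique_def)
  have xs: "\<not> E x s" using pendant_centre[OF q abs] .
  have leaf: "\<not> E x e" if "P3 E e s f" "e \<in> Y" "f \<in> Y" for e f
  proof
    assume xe: "E x e"
    then have "\<not> E x f" using cl[of e f] that by (auto simp: P3_def)
    then have "P4 E x e s f" using that xe xs by (auto simp: config_defs adj_commute)
    then show False using Y_P4_free q' that abs by (auto simp: P4_free_def)
  qed
  have bsa: "P3 E b s a" using abs by (auto simp: P3_def adj_commute)
  have xab: "\<not> E x a" "\<not> E x b" using leaf abs bsa by blast+
  have far: "\<not> E v s \<and> \<not> E v a \<and> \<not> E v b" if v: "v \<in> Y" "E x v" for v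
  proof -
    have vs: "\<not> E v s"
    proof
      assume vs: "E v s"
      have "E v e" if "E s e" "\<not> E x e" "e \<in> Y" for e
      proof (rule ccontr)
        assume "\<not> E v e"
        then have "P4 E x v s e" using v vs xs that by (auto simp: config_defs adj_commute)
        then show False using Y_P4_free q' v that abs by (auto simp: P4_free_def)
      qed
      then have "P3 E a v b" using abs xab by (auto simp: P3_def adj_commute)
      then show False using pendant_centre[OF q _ abs(2) v(1) abs(4)] v by blast
    qed
    have "\<not> E v e" if "E s e" "\<not> E x e" "e \<in> Y" for e
    proof
      assume "E v e"
      then have "P4 E x v e s" using v vs xs that by (auto simp: config_defs adj_commute)
      then show False using Y_P4_free q' v that abs by (auto simp: P4_free_def)
    qed
    then show ?thesis using vs abs xab by (auto simp: P3_def adj_commute)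
  qed
  have yz: "\<not> E y s" "\<not> E y a" "\<not> E y b" "\<not> E z s" "\<not> E z a" "\<not> E z b"
    using far q' by blast+
  have dY: "d \<noteq> v" if "v \<in> Y" for v using PY'[OF in_P(1)] PD'[OF in_P(1)] q' that by blast
  show False
  proof (cases "E d s")
    case True
    \<comment> \<open>A neighbour of \<open>s\<close> missed by \<open>d\<close> would end a P5 that
      starts at \<open>y\<close>.\<close>
    have "E d e" if "E s e" "e \<in> Y" "\<not> E x e" "\<not> E y e" "\<not> E z e" for e
      using no_P5[of y x d s e] True that q' xs yz by (auto simp: config_defs adj_commute)
    then have "E d a" "E d b" using abs xab yz by (auto simp: P3_def adj_commute)
    then show False
      using no_F9[OF P3 abs(1), of x y z d] True q' xs xab yz abs pd py
      by (auto simp: config_defs adj_commute)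
  next
    case False
    have "\<not> (E d a \<and> E d b)"
      using no_C4[of d a s b] dY[of s] False abs by (auto simp: P3_def adj_commute)
    moreover have "\<not> (E d a \<and> \<not> E d b)"
      using no_P5[of p d a s b] False abs pd py q' by (auto simp: config_defs adj_commute)
    moreover have "\<not> (E d b \<and> \<not> E d a)"
      using no_P5[of p d b s a] False abs pd py q' by (auto simp: config_defs adj_commute)
    ultimately have "\<not> E d a" "\<not> E d b" by blast+
    then show False
      using no_F2[of p d x y a s b] False q' xs xab yz abs pd py
      by (auto simp: config_defs adj_commute)
  qed
qed

text \<open>Without \<open>P3\<close>, \<open>Y\<close> is a disjoint union of cliques, and the
  triangles at \<open>x\<close> and \<open>x'\<close> lie in different ones. Whether
  \<open>d\<close> sees \<open>x'\<close> and \<open>d'\<close> sees \<open>x\<close> decides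
  between \<open>F4\<close> (both), \<open>F8\<close> (one) and P5 (none).\<close>

lemma pendant_unique:
  assumes q: "pendant d x y z" and r: "pendant d' x' y' z'"
    and P3_free: "\<And>a s b. a \<in> Y \<Longrightarrow> s \<in> Y \<Longrightarrow> b \<in> Y \<Longrightarrow> \<not> P3 E a s b"
  shows "x = x'"
proof (rule ccontr)
  assume neq: "x \<noteq> x'"
  have q': "d \<in> D" "x \<in> Y" "y \<in> Y" "z \<in> Y" "E x y" "E x z" "E y z" "E d x" "\<not> E d y" "\<not> E d z"
    using q by (auto simp: pendant_def K3_def)
  have r': "d' \<in> D" "x' \<in> Y" "y' \<in> Y" "z' \<in> Y" "E x' y'" "E x' z'" "E y' z'" "E d' x'" "\<not> E d' y'" "\<not> E d' z'"
    using r by (auto simp: pendant_def K3_def)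
  have tr: "E a c" if "E a b" "E b c" "a \<in> Y" "b \<in> Y" "c \<in> Y" "a \<noteq> c" for a b c
    using P3_free[of a b c] that by (auto simp: P3_def)
  have dY: "d \<noteq> v" "d' \<noteq> v" if "v \<in> Y" for v
    using PY'[OF in_P(1)] PD'[OF in_P(1)] q' r' that by blast+
  have dd: "d = d' \<or> E d d'" using D_clique q' r' by (auto simp: clique_def)
  have n: "\<not> E x x'"
  proof
    assume xx: "E x x'"
    then have "\<not> E d x'" "\<not> E d' x" using q r by (auto simp: pendant_def adj_commute)
    then show False using no_C4[of d x x' d'] dd dY[of x] dY[of x'] q' r' xx by (auto simp: adj_commute)
  qed
  have apart: "\<not> E v w" if "v \<in> {x, y, z}" "w \<in> {x', y', z'}" for v w
  proof
    assume "E v w"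
    have "v = x \<or> E x v" "w = x' \<or> E w x'" "v \<in> Y" "w \<in> Y" using that q' r' by (auto simp: adj_commute)
    then show False using \<open>E v w\<close> tr[of x v w] tr[of x w x'] n neq q'(2) r'(2) 
      by (metis adj_commute)
  qed
  then have ap: "\<not> E x x'" "\<not> E x y'" "\<not> E x z'" "\<not> E y x'" "\<not> E y y'" "\<not> E y z'" "\<not> E z x'" "\<not> E z y'" "\<not> E z z'"
    by auto
  \<comment> \<open>An \<open>e\<close> seeing \<open>y\<close> or \<open>z\<close> but not
    \<open>x\<close> would close an induced 4-cycle through \<open>d\<close> and
    \<open>x\<close>.\<close>
  have only_x: "\<not> E e y \<and> \<not> E e z" if "\<not> E e x" "e \<in> D" "e \<noteq> d" for e
  proof -
    have "E d e" using D_clique q' that by (auto simp: clique_def)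
    moreover have "e \<noteq> x" using PY'[OF in_P(1)] PD'[OF in_P(1)] q' that by blast
    ultimately show ?thesis
      using no_C4[of d x y e] no_C4[of d x z e] that q' dY[of y] dY[of z] by (auto simp: adj_commute)
  qed
  have only_x': "\<not> E e y' \<and> \<not> E e z'" if "\<not> E e x'" "e \<in> D" "e \<noteq> d'" for e
  proof -
    have "E d' e" using D_clique r' that by (auto simp: clique_def)
    moreover have "e \<noteq> x'" using PY'[OF in_P(1)] PD'[OF in_P(1)] r' that by blast
    ultimately show ?thesis
      using no_C4[of d' x' y' e] no_C4[of d' x' z' e] that r' dY[of y'] dY[of z'] by (auto simp: adj_commute)
  qed
  have all': "E d y' \<and> E d z'" if "E d x'"
    using no_P5[of y x d x' y'] no_P5[of y x d x' z'] that q' r' ap by (auto simp: config_defs adj_commute)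
  have all: "E d' y \<and> E d' z" if "E d' x"
    using no_P5[of y' x' d' x y] no_P5[of y' x' d' x z] that q' r' ap by (auto simp: config_defs adj_commute)
  have ne: "d \<noteq> d'" using all' q' r' by auto
  consider "E d x'" "E d' x" | "E d x'" "\<not> E d' x" | "\<not> E d x'" "E d' x" | "\<not> E d x'" "\<not> E d' x" by blast
  then show False
  proof cases
    case 1
    then show False
      using no_F4[of y x d' d x' y'] dd ne all all' q' r' ap by (auto simp: config_defs adj_commute)
  next
    case 2
    then show False
      using no_F8[of y' x' d' p x y z d] dd ne all' only_x[of d'] q' r' ap pd py
      by (auto simp: config_defs adj_commute)
  next
    case 3
    then show False
      using no_F8[of y x d p x' y' z' d'] dd ne all only_x'[of d] q' r' ap pd py
      by (auto simp: config_defs adj_commute)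
  next
    case 4
    then show False
      using no_P5[of y x d d' x'] dd ne only_x[of d'] q' r' ap by (auto simp: config_defs adj_commute)
  qed
qed

section \<open>Counting the vertices of high degree across a cutset\<close>

lemma count_step:
  assumes fin: "finite V" and V: "V = P \<union> D \<union> Y" and PY_disj: "P \<inter> Y = {}"
    and cl: "\<And>Q. Q \<subseteq> V \<Longrightarrow> clique E Q \<Longrightarrow> card Q \<le> k"
    and IH: "card {x \<in> P. k - card D \<le> card (nbrs E P x)} \<le> k - card D"
  shows "card {x \<in> V. k \<le> card (nbrs E V x)} \<le> k"
proof -
  define B where "B = {x \<in> V. k \<le> card (nbrs E V x)}"
  define CP where "CP = {s. centre P s}"
  define CY where "CY = {s. centre Y s}"
  have finP: "finite P" "finite D" "finite Y" using fin V by auto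
  have sub: "CP \<subseteq> P" "CY \<subseteq> Y" by (auto simp: CP_def CY_def centre_def)
  have finC: "finite CP" "finite CY" "finite B" using sub finP fin finite_subset by (auto simp: B_def)
  have PD_disj: "P \<inter> D = {}" using PD'(1) irrefl by blast
  have DY_disj: "D \<inter> Y = {}" using PD'(1)[OF in_P(1)] PY'(1)[OF in_P(1)] by blast
  \<comment> \<open>This bound leaves every vertex of \<open>B\<close> in \<open>Y\<close> at least
    two neighbours inside \<open>Y\<close>.\<close>
  have D2: "card D + 2 \<le> k"
  proof -
    have "clique E (insert p (insert u D))"
      using D_clique P3 pd unfolding clique_def P3_def by (auto simp: adj_commute)
    moreover have "insert p (insert u D) \<subseteq> V" using V in_P by auto
    moreover have "p \<noteq> u" using P3 irrefl by (auto simp: P3_def)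
    moreover have "p \<notin> D" "u \<notin> D" using in_P PD_disj by blast+
    ultimately show ?thesis
      using cl[of "insert p (insert u D)"] finP by simp
  qed
  have non_clique: "\<not> clique E (nbrs E V x)" if "x \<in> B" for x
  proof
    assume "clique E (nbrs E V x)"
    then have "clique E (insert x (nbrs E V x))" by (auto simp: clique_def adj_commute)
    then show False
      using cl[of "insert x (nbrs E V x)"] that fin irrefl by (auto simp: B_def nbrs_def)
  qed
  have nP: "nbrs E V x = D \<union> nbrs E P x" if "x \<in> P" for x
    using that PD' PY' V by auto
  have nY: "nbrs E V x = nbrs E D x \<union> nbrs E Y x" if "x \<in> Y" for x
    using that PY' V by auto
  \<comment> \<open>As \<open>D\<close> is a clique complete to \<open>P\<close>, two nonadjacent
    neighbours of \<open>x\<close> both lie in \<open>P\<close>.\<close>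
  have BP: "B \<inter> P \<subseteq> CP"
  proof
    fix x assume x: "x \<in> B \<inter> P"
    obtain y z where yz: "y \<in> nbrs E V x" "z \<in> nbrs E V x" "y \<noteq> z" "\<not> E y z"
      using non_clique[of x] x unfolding clique_def by blast
    have split: "w \<in> D \<or> w \<in> P" if "w \<in> nbrs E V x" for w using nP[of x] x that by auto
    have D_all: "E d w" if "d \<in> D" "w \<in> nbrs E V x" "w \<noteq> d" for d w
      using split[OF that(2)] that D_clique PD'(2) by (auto simp: clique_def)
    have "y \<notin> D" using D_all[of y z] yz by blast
    moreover have "z \<notin> D" using D_all[of z y] yz sym by blast
    ultimately have "y \<in> P" "z \<in> P" using split yz(1,2) by blast+
    moreover have "P3 E y x z" using yz by (auto simp: P3_def adj_commute)
    ultimately show "x \<in> CP" using x by (auto simp: CP_def centre_def)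
  qed
  have BY: "x \<in> CY \<or> (\<exists>d y z. pendant d x y z)" if x: "x \<in> B \<inter> Y" for x
  proof (cases "x \<in> CY")
    case nc: False
    have ny: "clique E (nbrs E Y x)"
      unfolding clique_def
    proof (intro ballI impI)
      fix y z assume yz: "y \<in> nbrs E Y x" "z \<in> nbrs E Y x" "y \<noteq> z"
      then have "\<not> P3 E y x z" using nc x by (auto simp: CY_def centre_def)
      then show "E y z" using yz by (auto simp: P3_def adj_commute)
    qed
    \<comment> \<open>The neighbours of \<open>x\<close> in \<open>D\<close> and those in
      \<open>Y\<close> are cliques, so a nonadjacent pair has one vertex in each.\<close>
    obtain y' d where yd: "y' \<in> Y" "d \<in> D" "E x y'" "E x d" "\<not> E d y'"
    proof -
      obtain y z where yz: "y \<in> nbrs E V x" "z \<in> nbrs E V x" "y \<noteq> z" "\<not> E y z"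
        using non_clique x unfolding clique_def by blast
      then have "\<not> (y \<in> D \<and> z \<in> D)" "\<not> (y \<in> Y \<and> z \<in> Y)"
        using D_clique ny by (auto simp: clique_def)
      moreover have "y \<in> D \<or> y \<in> Y" "z \<in> D \<or> z \<in> Y" using yz nY[of x] x by auto
      moreover have "E x y" "E x z" "\<not> E z y" using yz sym by auto
      ultimately show thesis using that[of y z] that[of z y] yz by blast
    qed
    have far: "\<not> E d w" if "w \<in> Y" "E x w" for w
    proof
      assume "E d w"
      then have "w \<noteq> y'" using yd by blast
      moreover have "w \<in> nbrs E Y x" "y' \<in> nbrs E Y x" using that yd by auto
      ultimately have "E w y'" using ny unfolding clique_def by blast
      then have "K3 E x w y'" using that yd by (simp add: K3_def)
      then show False using triangle_two[of d x w y'] \<open>E d w\<close> that yd x by (auto simp: adj_commute)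
    qed
    have "k \<le> card (nbrs E D x) + card (nbrs E Y x)"
      using x nY[of x] card_Un_le[of "nbrs E D x" "nbrs E Y x"] by (auto simp: B_def)
    moreover have "card (nbrs E D x) \<le> card D" using finP by (auto intro: card_mono simp: nbrs_def)
    ultimately have "2 \<le> card (nbrs E Y x)" using D2 by linarith
    then obtain y z where "y \<in> nbrs E Y x" "z \<in> nbrs E Y x" "y \<noteq> z"
      by (metis card_le_Suc0_iff_eq card.infinite not_less_eq_eq numeral_2_eq_2 zero_le)
    moreover have "E y z" using calculation ny unfolding clique_def by blast
    ultimately have "pendant d x y z"
      using yd ny far x sym[OF yd(4)] by (auto simp: pendant_def K3_def)
    then show ?thesis by blast
  qed simp
  have B_sub: "B \<subseteq> (B \<inter> P) \<union> D \<union> (B \<inter> Y)" using V by (auto simp: B_def)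
  have "card B \<le> k"
  proof (cases "B \<inter> Y = {}")
    case True
    \<comment> \<open>Restricting to \<open>P\<close> costs such a vertex at most
      \<open>card D\<close> neighbours, so the induction hypothesis counts it.\<close>
    have "B \<inter> P \<subseteq> {x \<in> P. k - card D \<le> card (nbrs E P x)}"
    proof
      fix x assume x: "x \<in> B \<inter> P"
      then have "k \<le> card (nbrs E V x)" by (simp add: B_def)
      also have "\<dots> \<le> card D + card (nbrs E P x)" using nP x card_Un_le by (metis IntD2)
      finally show "x \<in> {x \<in> P. k - card D \<le> card (nbrs E P x)}" using x by auto
    qed
    then have "card (B \<inter> P) \<le> k - card D"
      using IH finP by (intro order.trans[OF card_mono IH]) auto
    moreover have "card B \<le> card (B \<inter> P) + card D"
      using B_sub True finC finP card_mono[of "(B \<inter> P) \<union> D" B] card_Un_le[of "B \<inter> P" D] by auto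
    ultimately show ?thesis using D2 by linarith
  next
    case False
    then obtain x0 where x0: "x0 \<in> B \<inter> Y" by blast
    have free: "P4_free P \<and> two_P3_free P"
    proof (cases "x0 \<in> CY")
      case True
      then show ?thesis using P3_P4_free P3_two_P3_free by (auto simp: CY_def centre_def)
    next
      case False
      then show ?thesis using BY[OF x0] pendant_P4_free pendant_two_P3_free by blast
    qed
    have cu: "centre P u" using in_P P3 by (auto simp: centre_def)
    obtain x where x: "x \<in> P" "x \<notin> CP" "clique E (insert x CP)"
      using centres_clique[OF finP(1) _ _ cu] free by (metis CP_def mem_Collect_eq)
    have "clique E (insert x CP \<union> D)"
      using x D_clique PD' sub unfolding clique_def by blast
    moreover have "insert x CP \<union> D \<subseteq> V" using x sub V by auto
    moreover have "card (insert x CP \<union> D) = card CP + 1 + card D"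
      using x sub PD_disj finC finP by (subst card_Un_disjoint) auto
    \<comment> \<open>The non-centre \<open>x\<close> makes room for one vertex of \<open>B\<close>
      in \<open>Y\<close>.\<close>
    ultimately have CPD: "card CP + 1 + card D \<le> k" using cl by metis
    have bound: "card B \<le> card CP + card D + card (B \<inter> Y)"
    proof -
      have "card B \<le> card (CP \<union> D \<union> (B \<inter> Y))"
        using B_sub BP finC finP by (intro card_mono) auto
      also have "\<dots> \<le> card (CP \<union> D) + card (B \<inter> Y)" by (rule card_Un_le)
      also have "\<dots> \<le> card CP + card D + card (B \<inter> Y)" using card_Un_le by auto
      finally show ?thesis .
    qed
    show ?thesis
    proof (cases "card (B \<inter> Y) \<le> 1")
      case True
      then show ?thesis using CPD bound by linarith
    next
      case False
      then obtain x1 x2 where x12: "x1 \<in> B \<inter> Y" "x2 \<in> B \<inter> Y" "x1 \<noteq> x2"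
        using finC by (metis One_nat_def card_le_Suc0_iff_eq finite_Int)
      \<comment> \<open>Without a \<open>P3\<close> in \<open>Y\<close>, both \<open>x1\<close> and
        \<open>x2\<close> would be pendant, against uniqueness.\<close>
      have "\<exists>a\<in>Y. \<exists>s\<in>Y. \<exists>b\<in>Y. P3 E a s b"
      proof (rule ccontr)
        assume n: "\<not> ?thesis"
        then have "CY = {}" by (auto simp: CY_def centre_def)
        then show False using BY x12 n pendant_unique by (metis empty_iff)
      qed
      then have np: "\<not> pendant d x y z" for d x y z using pendant_no_P3 by blast
      then have BCY: "B \<inter> Y \<subseteq> CY" using BY by blast
      note Yf = Y_P4_free Y_two_P3_free
      have cx: "centre Y x1" "centre Y x2" using BCY x12 by (auto simp: CY_def)
      \<comment> \<open>With two centres available, each centre has degree 3 in a diamond of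
        \<open>Y\<close>, and \<open>diamond_full\<close> applies.\<close>
      have DCY: "E d t" if "d \<in> D" "centre Y t" for d t
      proof -
        obtain t' where "centre Y t'" "t' \<noteq> t" using cx x12 by metis
        then show ?thesis
          using two_centres_diamond[OF Yf that(2)] diamond_full(1)[OF that(1)] that(2) unfolding centre_def by metis
      qed
      obtain y where y: "y \<in> Y" "y \<notin> CY" "clique E (insert y CY)"
        using centres_clique[OF finP(3) Yf cx(1)] by (metis CY_def mem_Collect_eq)
      have Dy: "E d y" if "d \<in> D" for d
      proof -
        have "K3 E x1 x2 y" using y cx x12 by (auto simp: K3_def clique_def CY_def)
        then show ?thesis using triangle_two[OF that] DCY[OF that] cx y x12 by blast
      qed
      have "clique E (insert y CY \<union> D)"
        using y D_clique Dy DCY sym unfolding clique_def CY_def by blast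
      moreover have "insert y CY \<union> D \<subseteq> V" using y sub V by auto
      moreover have "card (insert y CY \<union> D) = card CY + 1 + card D"
        using y sub DY_disj finC finP by (subst card_Un_disjoint) auto
      ultimately have CYD: "card CY + 1 + card D \<le> k" using cl by metis
      \<comment> \<open>Two centres in \<open>P\<close> would give a diamond anticomplete to one in
        \<open>Y\<close>, which is \<open>F6\<close>. The single centre that may remain is paid for
        by the non-centre \<open>y\<close> in \<open>CYD\<close>.\<close>
      have "card CP \<le> 1"
      proof (rule ccontr)
        assume "\<not> ?thesis"
        then obtain s t where st: "centre P s" "centre P t" "s \<noteq> t"
          using finC by (metis CP_def One_nat_def card_le_Suc0_iff_eq mem_Collect_eq)
        obtain a b where ab: "a \<in> P" "b \<in> P" "is_diamond E s t a b" using two_centres_diamond free st by metis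
        obtain a' b' where ab': "a' \<in> Y" "b' \<in> Y" "is_diamond E x1 x2 a' b'"
          using two_centres_diamond Yf cx x12 by metis
        show False
          using no_F6[OF ab(3) ab'(3)] ab ab' st x12 PY' by (auto simp: anti_def centre_def)
      qed
      moreover have "card (B \<inter> Y) \<le> card CY" using BCY finC card_mono by blast
      ultimately show ?thesis using CYD bound by linarith
    qed
  qed
  then show ?thesis by (simp add: B_def)
qed

end

section \<open>Existence of the cutset, and the induction\<close>

context free_graph begin

text \<open>By \<open>side\<close>, a neighbour of \<open>u\<close> that does not dominate
  \<open>u\<close> is private and has a nonadjacent private partner. The two
  \<open>private_closed\<close> lemmas then keep all its neighbours adjacent or equal to
  \<open>u\<close>.\<close>

lemma clique_cutset_exists:
  assumes fin: "finite V" and cl: "\<And>Q. Q \<subseteq> V \<Longrightarrow> clique E Q \<Longrightarrow> card Q \<le> k"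
    and uv: "u \<in> V" "v \<in> V" "u \<noteq> v" "\<not> E u v"
    and deg: "k \<le> card (nbrs E V u)" "k \<le> card (nbrs E V v)"
    and side: "\<And>w a. E u w \<Longrightarrow> E v w \<Longrightarrow> E u a \<Longrightarrow> \<not> E v a \<Longrightarrow> E a w"
  obtains P D Y p p' where "clique_cutset E P D Y p u p'" "V = P \<union> D \<union> Y" "P \<inter> Y = {}" "v \<in> Y"
proof -
  have non_clique: "\<not> clique E (nbrs E V x)" if "x \<in> V" "k \<le> card (nbrs E V x)" for x
  proof
    assume "clique E (nbrs E V x)"
    then have "clique E (insert x (nbrs E V x))" by (auto simp: clique_def adj_commute)
    then show False
      using cl[of "insert x (nbrs E V x)"] that fin irrefl by (auto simp: nbrs_def)
  qed
  have common: "E w w'" if "E u w" "E v w" "E u w'" "E v w'" "w \<noteq> w'" for w w'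
    using no_C4[of u w v w'] uv that by (auto simp: adj_commute)
  \<comment> \<open>Common neighbours are adjacent to each other and to all private neighbours of
    \<open>u\<close>, so both vertices of a nonadjacent pair are private.\<close>
  obtain a a' where a: "a \<in> V" "a' \<in> V" "E u a" "\<not> E v a" "E u a'" "\<not> E v a'" "a \<noteq> a'" "\<not> E a a'"
  proof -
    obtain y z where yz: "y \<in> nbrs E V u" "z \<in> nbrs E V u" "y \<noteq> z" "\<not> E y z"
      using non_clique uv deg unfolding clique_def by blast
    then have "\<not> E v y" "\<not> E v z" using common side sym by (metis nbrs_iff)+
    then show thesis using yz that by auto
  qed
  have closed: "E u x" if b: "E u b" "\<not> E v b" "E u b'" "\<not> E v b'" "b \<noteq> b'" "\<not> E b b'"
    and x: "E b x" "x \<noteq> u" for b b' x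
  proof (cases "\<exists>c c'. E v c \<and> \<not> E u c \<and> E v c' \<and> \<not> E u c' \<and> c \<noteq> c' \<and> \<not> E c c'")
    case True
    then show ?thesis using private_closed_P3 uv b x by blast
  next
    case False
    \<comment> \<open>Both the common and the private neighbours of \<open>v\<close> are now
      cliques, so a nonadjacent pair has one of each kind.\<close>
    obtain w c where w: "E u w" "E v w" and c: "c \<in> V" "E v c" "\<not> E u c" "\<not> E c w"
    proof -
      obtain y z where yz: "y \<in> nbrs E V v" "z \<in> nbrs E V v" "y \<noteq> z" "\<not> E y z"
        using non_clique uv deg unfolding clique_def by blast
      have zy: "\<not> E z y" using yz sym by blast
      have vyz: "E v y" "E v z" "y \<in> V" "z \<in> V" using yz by auto
      consider "E u y" "E u z" | "\<not> E u y" "\<not> E u z" | "E u y" "\<not> E u z" | "\<not> E u y" "E u z"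
        by blast
      then show thesis
      proof cases
        case 1
        then show ?thesis using common[of y z] vyz yz by blast
      next
        case 2
        then show ?thesis using False vyz yz by blast
      next
        case 3
        then show ?thesis using that[of y z] vyz zy by blast
      next
        case 4
        then show ?thesis using that[of z y] vyz yz by blast
      qed
    qed
    \<comment> \<open>The clique on \<open>u\<close>, \<open>a\<close> and \<open>K\<close> gives
      \<open>card K + 2 \<le> k\<close>. As \<open>v\<close> has degree at least \<open>k\<close>,
      it has a second private neighbour \<open>c'\<close>.\<close>
    define K where "K = {w \<in> V. E u w \<and> E v w}"
    define C where "C = {c \<in> V. E v c \<and> \<not> E u c}"
    have finK: "finite K" "finite C" using fin by (auto simp: K_def C_def)
    have "clique E (insert u (insert a K))"
    proof -
      have "clique E K" using common by (auto simp: clique_def K_def)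
      moreover have "E a w" "E u w" if "w \<in> K" for w using side a that by (auto simp: K_def)
      ultimately show ?thesis using a by (auto simp: clique_insert)
    qed
    moreover have "insert u (insert a K) \<subseteq> V" using uv a by (auto simp: K_def)
    ultimately have "card (insert u (insert a K)) \<le> k" using cl by blast
    moreover have "card (insert u (insert a K)) = card K + 2"
      using finK a irrefl by (auto simp: K_def card_insert_if)
    moreover have "card (nbrs E V v) = card K + card C"
    proof -
      have "nbrs E V v = K \<union> C" by (auto simp: K_def C_def)
      then show ?thesis using finK by (simp add: card_Un_disjoint K_def C_def disjoint_iff)
    qed
    ultimately have "\<not> C \<subseteq> {c}" using deg card_mono[of "{c}" C] by auto
    then obtain c' where c': "E v c'" "\<not> E u c'" "c' \<noteq> c" by (auto simp: C_def)
    then have "E c c'" using False c by blast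
    then show ?thesis
      using private_closed_edge[of u v b b' w c c' x] uv b x w c c' side by (auto simp: adj_commute)
  qed
  define D where "D = {d \<in> V. E u d \<and> (\<forall>x\<in>V. E u x \<longrightarrow> x \<noteq> d \<longrightarrow> E d x)}"
  define P where "P = insert u {z \<in> V. E u z \<and> z \<notin> D}"
  define Y where "Y = {y \<in> V. y \<noteq> u \<and> \<not> E u y}"
  \<comment> \<open>All common neighbours of \<open>u\<close> and \<open>v\<close> lie in
    \<open>D\<close>, so two nonadjacent neighbours of \<open>u\<close> are private.\<close>
  have notD: "\<exists>z'\<in>V. E u z' \<and> \<not> E v z' \<and> z \<noteq> z' \<and> \<not> E z z' \<and> \<not> E v z" if z: "z \<in> V" "E u z" "z \<notin> D" for z
  proof -
    obtain z' where z': "z' \<in> V" "E u z'" "z' \<noteq> z" "\<not> E z z'" using z by (auto simp: D_def)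
    then have "\<not> E v z" "\<not> E v z'" using common side z sym by metis+
    then show ?thesis using z' by blast
  qed
  have "clique_cutset E P D Y a u a'"
  proof (intro clique_cutset.intro free_graph_axioms clique_cutset_axioms.intro)
    show "clique E D" by (auto simp: clique_def D_def)
    show "full E P D" unfolding full_def P_def D_def using sym by blast
    show "anti E P Y"
      using notD closed unfolding anti_def P_def Y_def by blast
    show "P3 E a u a'" using a by (auto simp: P3_def adj_commute)
    show "a \<in> P" "u \<in> P" "a' \<in> P" using a by (auto simp: P_def D_def adj_commute)
  qed
  moreover have "V = P \<union> D \<union> Y" using uv by (auto simp: P_def D_def Y_def)
  moreover have "P \<inter> Y = {}" by (auto simp: P_def Y_def)
  moreover have "v \<in> Y" using uv by (auto simp: Y_def)
  ultimately show thesis using that by blast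
qed

text \<open>The induction varies \<open>k\<close> together with \<open>V\<close>: cliques of
  \<open>P\<close> extend by all of \<open>D\<close>, so \<open>P\<close> meets the hypothesis with
  \<open>k - card D\<close>.\<close>

theorem card_high_degree:
  assumes "finite V" "\<And>Q. Q \<subseteq> V \<Longrightarrow> clique E Q \<Longrightarrow> card Q \<le> k"
  shows "card {x \<in> V. k \<le> card (nbrs E V x)} \<le> k"
  using assms
proof (induction "card V" arbitrary: V k rule: less_induct)
  case less
  note fin = less.prems(1) and cl = less.prems(2)
  show ?case
  proof (cases "clique E {x \<in> V. k \<le> card (nbrs E V x)}")
    case True
    then show ?thesis using cl by simp
  next
    case False
    then obtain u v where uv: "u \<in> V" "v \<in> V" "u \<noteq> v" "\<not> E u v"
      and deg: "k \<le> card (nbrs E V u)" "k \<le> card (nbrs E V v)" by (auto simp: clique_def)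
    have vu: "v \<noteq> u" "\<not> E v u" using uv sym by blast+
    have "\<exists>P D Y p q p'. clique_cutset E P D Y p q p' \<and> V = P \<union> D \<union> Y \<and> P \<inter> Y = {} \<and> Y \<noteq> {}"
      using common_full_one_side[OF uv(3,4)]
    proof
      assume *: "\<forall>w a. E u w \<and> E v w \<and> E u a \<and> \<not> E v a \<longrightarrow> E a w"
      show ?thesis by (rule clique_cutset_exists[OF fin cl uv deg]) (use * in blast)+
    next
      assume *: "\<forall>w c. E u w \<and> E v w \<and> E v c \<and> \<not> E u c \<longrightarrow> E c w"
      show ?thesis by (rule clique_cutset_exists[OF fin cl uv(2,1) vu deg(2,1)]) (use * in blast)+
    qed
    then obtain P D Y p q p' where sp: "clique_cutset E P D Y p q p'"
      and V: "V = P \<union> D \<union> Y" "P \<inter> Y = {}" "Y \<noteq> {}" by blast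
    interpret S: clique_cutset E P D Y p q p' by fact
    have finP: "finite P" "finite D" using fin V by auto
    have PD: "P \<inter> D = {}" using S.PD'(1) irrefl by blast
    have "P \<subset> V" using V by auto
    then have "card P < card V" using fin psubset_card_mono by blast
    moreover have "card Q \<le> k - card D" if "Q \<subseteq> P" "clique E Q" for Q
    proof -
      have "clique E (Q \<union> D)" using that S.D_clique S.PD' unfolding clique_def by blast
      then have "card (Q \<union> D) \<le> k" using cl that V by blast
      moreover have "card (Q \<union> D) = card Q + card D"
        using that PD finP finite_subset by (intro card_Un_disjoint) blast+
      ultimately show ?thesis by simp
    qed
    ultimately have "card {x \<in> P. k - card D \<le> card (nbrs E P x)} \<le> k - card D"
      using less.hyps finP by blast
    then show ?thesis using S.count_step[OF fin V(1,2)] cl by blast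
  qed
qed

end

section \<open>Induced subgraphs and short cycles\<close>

context
  fixes G :: "('a, 'b) pre_digraph"
  assumes graph_G: "graph G"
begin

interpretation graph G by (fact graph_G)

lemma dominates_sym: "u \<rightarrow>\<^bsub>G\<^esub> v \<Longrightarrow> v \<rightarrow>\<^bsub>G\<^esub> u"
  by (rule arcs_ends_symmetric[OF sym_arcs])

lemma dominates_irrefl: "\<not> u \<rightarrow>\<^bsub>G\<^esub> u"
  using no_loops by (auto simp: arcs_ends_conv)

lemma digraph_iso_induced:
  assumes V: "A \<subseteq> V \<times> V" and inj: "inj_on f V" and verts: "f ` V \<subseteq> verts G"
    and adj: "\<And>i j. i \<in> V \<Longrightarrow> j \<in> V \<Longrightarrow> f i \<rightarrow>\<^bsub>G\<^esub> f j \<longleftrightarrow> (i, j) \<in> A \<or> (j, i) \<in> A"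
  shows "digraph_iso (G \<restriction> f ` V) (sgraph V A)"
proof -
  define g where "g = the_inv_into V f"
  have gf: "g (f i) = i" if "i \<in> V" for i
    unfolding g_def using inj that by (rule the_inv_into_f_f)
  \<comment> \<open>Arcs go to the pairs of labels of their ends, which is injective because
    \<open>G\<close> has no parallel arcs.\<close>
  define h where "h = \<lparr>iso_verts = g, iso_arcs = \<lambda>e. (g (tail G e), g (head G e)),
    iso_head = snd, iso_tail = fst\<rparr>"
  have injg: "inj_on g (f ` V)" by (rule inj_onI) (auto simp: gf)
  have "pre_digraph.digraph_isomorphism (G \<restriction> f ` V) h"
    unfolding pre_digraph.digraph_isomorphism_def
  proof (intro conjI)
    show "wf_digraph (G \<restriction> f ` V)" by (rule wellformed_induce_subgraph)
    show "inj_on (iso_verts h) (verts (G \<restriction> f ` V))" using injg by (simp add: h_def)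
    show "inj_on (iso_arcs h) (arcs (G \<restriction> f ` V))"
    proof (rule inj_onI)
      fix e e' assume *: "e \<in> arcs (G \<restriction> f ` V)" "e' \<in> arcs (G \<restriction> f ` V)" "iso_arcs h e = iso_arcs h e'"
      then have "tail G e = tail G e'" "head G e = head G e'"
        using inj_onD[OF injg] by (auto simp: h_def)
      then show "e = e'" using * no_multi_arcs by (auto simp: arc_to_ends_def)
    qed
  qed (auto simp: h_def)
  moreover have "sgraph V A = app_iso h (G \<restriction> f ` V)"
  proof (rule pre_digraph.equality)
    show "verts (sgraph V A) = verts (app_iso h (G \<restriction> f ` V))"
      by (force simp: sgraph_def h_def gf)
    show "arcs (sgraph V A) = arcs (app_iso h (G \<restriction> f ` V))"
    proof (intro set_eqI iffI)
      fix x assume x: "x \<in> arcs (sgraph V A)"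
      then obtain i j where ij: "x = (i, j)" "i \<in> V" "j \<in> V" "(i, j) \<in> A \<or> (j, i) \<in> A"
        using V by (auto simp: sgraph_def)
      then have "f i \<rightarrow>\<^bsub>G\<^esub> f j" using adj by blast
      then obtain e where "e \<in> arcs G" "tail G e = f i" "head G e = f j" by (auto simp: arcs_ends_conv)
      then show "x \<in> arcs (app_iso h (G \<restriction> f ` V))"
        using ij gf by (auto simp: h_def intro!: image_eqI[of _ _ e])
    next
      fix x assume "x \<in> arcs (app_iso h (G \<restriction> f ` V))"
      then obtain e i j where e: "e \<in> arcs G" "tail G e = f i" "head G e = f j" "i \<in> V" "j \<in> V"
        "x = (g (f i), g (f j))" by (auto simp: h_def)
      then have "f i \<rightarrow>\<^bsub>G\<^esub> f j" using dominatesI[of e] by (simp add: arc_to_ends_def)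
      then show "x \<in> arcs (sgraph V A)" using e gf adj by (auto simp: sgraph_def)
    qed
  qed (simp_all add: sgraph_def h_def)
  ultimately show ?thesis unfolding digraph_iso_def by blast
qed

text \<open>Vertex \<open>i\<close> of the pattern is played by \<open>xs ! i\<close>. The pattern
  has no isolated vertices, so adjacency alone places every \<open>xs ! i\<close> in
  \<open>verts G\<close>.\<close>

lemma list_not_forbidden:
  assumes free: "\<And>F H. F \<in> forbidden_graphs \<Longrightarrow> induced_subgraph H G \<Longrightarrow> \<not> digraph_iso H F"
    and F: "F \<in> forbidden_graphs" "F = sgraph V A" "A \<subseteq> V \<times> V"
    and xs: "distinct xs" "\<forall>i\<in>V. i < length xs" "\<forall>i\<in>V. \<exists>j\<in>V. (i, j) \<in> A \<or> (j, i) \<in> A"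
    and adj: "\<forall>i\<in>V. \<forall>j\<in>V. xs ! i \<rightarrow>\<^bsub>G\<^esub> xs ! j \<longleftrightarrow> (i, j) \<in> A \<or> (j, i) \<in> A"
  shows False
proof -
  have sub: "(!) xs ` V \<subseteq> verts G" using xs(3) adj adj_in_verts(1) by blast
  have "digraph_iso (G \<restriction> (!) xs ` V) (sgraph V A)"
    using xs F sub adj by (intro digraph_iso_induced inj_on_nth) auto
  then show False using free[OF F(1) induced_induce[OF sub]] F(2) by simp
qed

lemma dominates_commute: "u \<rightarrow>\<^bsub>G\<^esub> v \<longleftrightarrow> v \<rightarrow>\<^bsub>G\<^esub> u"
  using dominates_sym by blast

lemma dominatesE:
  assumes "u \<rightarrow>\<^bsub>G\<^esub> v"
  obtains e where "e \<in> arcs G" "arc_to_ends G e = (u, v)"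
  using assms unfolding arcs_ends_def by force

lemma chordal_no_C4:
  assumes "chordal G" "a \<rightarrow>\<^bsub>G\<^esub> b" "b \<rightarrow>\<^bsub>G\<^esub> c" "c \<rightarrow>\<^bsub>G\<^esub> d" "d \<rightarrow>\<^bsub>G\<^esub> a" "\<not> a \<rightarrow>\<^bsub>G\<^esub> c" "\<not> b \<rightarrow>\<^bsub>G\<^esub> d"
    and "a \<noteq> c" "b \<noteq> d"
  shows False
proof -
  obtain e1 where e1: "e1 \<in> arcs G" "arc_to_ends G e1 = (a, b)"
    using dominatesE assms(2) .
  obtain e2 where e2: "e2 \<in> arcs G" "arc_to_ends G e2 = (b, c)"
    using dominatesE assms(3) .
  obtain e3 where e3: "e3 \<in> arcs G" "arc_to_ends G e3 = (c, d)"
    using dominatesE assms(4) .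
  obtain e4 where e4: "e4 \<in> arcs G" "arc_to_ends G e4 = (d, a)"
    using dominatesE assms(5) .
  note e = e1 e2 e3 e4
  have neq: "a \<noteq> b" "b \<noteq> c" "c \<noteq> d" "d \<noteq> a" using assms dominates_irrefl by blast+
  have "cycle [e1, e2, e3, e4]"
    unfolding cycle_def awalk_def using e neq assms(8,9) adj_in_verts[OF assms(2)]
    by (auto simp: arc_to_ends_def)
  then obtain u v where "chord G [e1, e2, e3, e4] u v"
    using assms(1) unfolding chordal_def by force
  then have "u \<in> {a, b, c, d}" "v \<in> {a, b, c, d}" "u \<rightarrow>\<^bsub>G\<^esub> v"
    "(u, v) \<notin> {(a, b), (b, c), (c, d), (d, a)}" "(v, u) \<notin> {(a, b), (b, c), (c, d), (d, a)}"
    using e by (simp_all add: chord_def arc_to_ends_def)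
  then show False
    using assms(6,7) dominates_irrefl by (elim insertE emptyE; simp add: dominates_commute)
qed

lemma chordal_no_C5:
  assumes "chordal G" "a \<rightarrow>\<^bsub>G\<^esub> b" "b \<rightarrow>\<^bsub>G\<^esub> c" "c \<rightarrow>\<^bsub>G\<^esub> d" "d \<rightarrow>\<^bsub>G\<^esub> e" "e \<rightarrow>\<^bsub>G\<^esub> a"
    and "\<not> a \<rightarrow>\<^bsub>G\<^esub> c" "\<not> a \<rightarrow>\<^bsub>G\<^esub> d" "\<not> b \<rightarrow>\<^bsub>G\<^esub> d" "\<not> b \<rightarrow>\<^bsub>G\<^esub> e" "\<not> c \<rightarrow>\<^bsub>G\<^esub> e"
  shows False
proof -
  obtain e1 where e1: "e1 \<in> arcs G" "arc_to_ends G e1 = (a, b)"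
    using dominatesE assms(2) .
  obtain e2 where e2: "e2 \<in> arcs G" "arc_to_ends G e2 = (b, c)"
    using dominatesE assms(3) .
  obtain e3 where e3: "e3 \<in> arcs G" "arc_to_ends G e3 = (c, d)"
    using dominatesE assms(4) .
  obtain e4 where e4: "e4 \<in> arcs G" "arc_to_ends G e4 = (d, e)"
    using dominatesE assms(5) .
  obtain e5 where e5: "e5 \<in> arcs G" "arc_to_ends G e5 = (e, a)"
    using dominatesE assms(6) .
  note e = e1 e2 e3 e4 e5
  have neq: "distinct [a, b, c, d, e]" using assms dominates_irrefl by (auto simp: dominates_commute)
  have "cycle [e1, e2, e3, e4, e5]"
    unfolding cycle_def awalk_def using e neq adj_in_verts[OF assms(2)]
    by (auto simp: arc_to_ends_def)
  then obtain u v where "chord G [e1, e2, e3, e4, e5] u v"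
    using assms(1) unfolding chordal_def by force
  then have "u \<in> {a, b, c, d, e}" "v \<in> {a, b, c, d, e}" "u \<rightarrow>\<^bsub>G\<^esub> v"
    "(u, v) \<notin> {(a, b), (b, c), (c, d), (d, e), (e, a)}" "(v, u) \<notin> {(a, b), (b, c), (c, d), (d, e), (e, a)}"
    using e by (simp_all add: chord_def arc_to_ends_def)
  then show False
    using assms(7-11) dominates_irrefl by (elim insertE emptyE; simp add: dominates_commute)
qed

lemma free_graph_dominates:
  assumes chordal: "chordal G"
    and free: "\<And>F H. F \<in> forbidden_graphs \<Longrightarrow> induced_subgraph H G \<Longrightarrow> \<not> digraph_iso H F"
  shows "free_graph (dominates G)"
proof -
  show ?thesis
  proof
    fix x y assume "x \<rightarrow>\<^bsub>G\<^esub> y" then show "y \<rightarrow>\<^bsub>G\<^esub> x" by (rule dominates_sym)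
  next
    fix x show "\<not> x \<rightarrow>\<^bsub>G\<^esub> x" by (rule dominates_irrefl)
  next
    fix a b c d e f g h i l m p q r s t v w x y
    show "a \<rightarrow>\<^bsub>G\<^esub> b \<Longrightarrow> b \<rightarrow>\<^bsub>G\<^esub> c \<Longrightarrow> c \<rightarrow>\<^bsub>G\<^esub> d \<Longrightarrow> d \<rightarrow>\<^bsub>G\<^esub> a \<Longrightarrow> \<not> a \<rightarrow>\<^bsub>G\<^esub> c \<Longrightarrow> \<not> b \<rightarrow>\<^bsub>G\<^esub> d \<Longrightarrow>
        a \<noteq> c \<Longrightarrow> b \<noteq> d \<Longrightarrow> False"
      using chordal_no_C4[OF chordal] .
    show "P4 (dominates G) a b c d \<Longrightarrow> d \<rightarrow>\<^bsub>G\<^esub> e \<Longrightarrow> e \<rightarrow>\<^bsub>G\<^esub> a \<Longrightarrow> \<not> b \<rightarrow>\<^bsub>G\<^esub> e \<Longrightarrow> \<not> c \<rightarrow>\<^bsub>G\<^esub> e \<Longrightarrow> False"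
      using chordal_no_C5[OF chordal, of a b c d e] by (auto simp: P4_def)
    show False if "P4 (dominates G) a b c d" "d \<rightarrow>\<^bsub>G\<^esub> e" "anti (dominates G) {a, b, c} {e}"
      by (rule list_not_forbidden[OF free _ F1_def[unfolded path_on_def], where xs = "[a, b, c, d, e]"])
        (use that in \<open>auto simp: forbidden_graphs_def config_defs dominates_irrefl dominates_commute\<close>)
    show False if "P4 (dominates G) a b c d" "P3 (dominates G) e f g" "anti (dominates G) {a, b, c, d} {e, f, g}"
      by (rule list_not_forbidden[OF free _ F2_def[unfolded path_on_def union_sgraph], where xs = "[a, b, c, d, e, f, g]"])
        (use that in \<open>auto simp: forbidden_graphs_def config_defs dominates_irrefl dominates_commute\<close>)
    show False if "P3 (dominates G) a b c" "P3 (dominates G) d e f" "P3 (dominates G) g h i" "anti (dominates G) {a, b, c} {d, e, f, g, h, i}" "anti (dominates G) {d, e, f} {g, h, i}"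
      by (rule list_not_forbidden[OF free _ F3_def[unfolded path_on_def union_sgraph], where xs = "[a, b, c, d, e, f, g, h, i]"])
        (use that in \<open>auto simp: forbidden_graphs_def config_defs dominates_irrefl dominates_commute\<close>)
    \<comment> \<open>\<open>F4\<close> is the square of a path on six vertices. The assumptions
      follow that path, whereas \<open>xs\<close> lists its vertices in the numbering of
      \<open>F4\<close>.\<close>
    show False if "K3 (dominates G) a b c" "K3 (dominates G) b c d" "K3 (dominates G) c d e" "K3 (dominates G) d e f" "anti (dominates G) {a} {d, e, f}" "anti (dominates G) {b} {e, f}" "\<not> c \<rightarrow>\<^bsub>G\<^esub> f"
      by (rule list_not_forbidden[OF free _ F4_def[unfolded Let_def], where xs = "[c, e, b, d, a, f]"])
        (use that in \<open>auto simp: forbidden_graphs_def config_defs dominates_irrefl dominates_commute\<close>)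
    show False if "is_diamond (dominates G) p s l m" "is_diamond (dominates G) m r q t" "anti (dominates G) {l, p, s} {q, r, t}"
      by (rule list_not_forbidden[OF free _ F5_def[unfolded Let_def], where xs = "[l, m, p, q, r, s, t]"])
        (use that in \<open>auto simp: forbidden_graphs_def config_defs dominates_irrefl dominates_commute\<close>)
    show False if "is_diamond (dominates G) a b c d" "is_diamond (dominates G) e f g h" "anti (dominates G) {a, b, c, d} {e, f, g, h}"
      by (rule list_not_forbidden[OF free _ F6_def[unfolded diamond_def union_sgraph], where xs = "[a, b, c, d, e, f, g, h]"])
        (use that in \<open>auto simp: forbidden_graphs_def config_defs dominates_irrefl dominates_commute\<close>)
    show False if "is_diamond (dominates G) a b c d" "is_diamond (dominates G) e f g h" "a \<rightarrow>\<^bsub>G\<^esub> e" "anti (dominates G) {b, c, d} {e, f, g, h}" "anti (dominates G) {a} {f, g, h}"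
      by (rule list_not_forbidden[OF free _ F7_def[unfolded F6_def diamond_def path_on_def union_sgraph], where xs = "[a, b, c, d, e, f, g, h]"])
        (use that in \<open>auto simp: forbidden_graphs_def config_defs dominates_irrefl dominates_commute\<close>)
    show False if "P4 (dominates G) a b c d" "K3 (dominates G) w x y" "full (dominates G) {v} {a, b, c, d, w}" "anti (dominates G) {v} {x, y}" "anti (dominates G) {a, b, c, d} {w, x, y}"
      by (rule list_not_forbidden[OF free _ F8_def[unfolded Let_def], where xs = "[a, b, c, d, v, w, x, y]"])
        (use that in \<open>auto simp: forbidden_graphs_def config_defs dominates_irrefl dominates_commute\<close>)
    show False if "P3 (dominates G) a b c" "P3 (dominates G) d e f" "K3 (dominates G) w x y" "full (dominates G) {v} {a, b, c, d, e, f, w}" "anti (dominates G) {v} {x, y}" "anti (dominates G) {a, b, c} {d, e, f, w, x, y}" "anti (dominates G) {d, e, f} {w, x, y}"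
      by (rule list_not_forbidden[OF free _ F9_def[unfolded Let_def], where xs = "[a, b, c, d, e, f, v, w, x, y]"])
        (use that in \<open>auto simp: forbidden_graphs_def config_defs dominates_irrefl dominates_commute\<close>)
  qed
qed

end

section \<open>b-colorings\<close>

lemma clique_card_le_coloring:
  assumes "coloring H k c" "Q \<subseteq> verts H" "clique (dominates H) Q"
  shows "card Q \<le> k"
proof -
  have "inj_on c Q"
    using assms unfolding inj_on_def clique_def coloring_def by metis
  moreover have "c ` Q \<subseteq> {1..k}" using assms by (auto simp: coloring_def)
  ultimately show ?thesis using card_inj_on_le[of c Q "{1..k}"] by simp
qed

lemma unused_color:
  assumes "coloring H k c" "i \<in> {1..k}" "\<forall>v\<in>verts H. c v \<noteq> i" "graph H"
  shows "\<exists>c'. coloring H (k - 1) c'"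
proof -
  interpret graph H by fact
  define c' where "c' v = (if c v = k then i else c v)" for v
  have "c' v \<in> {1..k - 1}" if "v \<in> verts H" for v
  proof -
    have "c v \<in> {1..k}" "c v \<noteq> i" using assms that by (auto simp: coloring_def)
    then show ?thesis using assms(2) by (auto simp: c'_def)
  qed
  moreover have "c' u \<noteq> c' v" if "u \<rightarrow>\<^bsub>H\<^esub> v" for u v
  proof -
    have "c u \<noteq> i" "c v \<noteq> i" "c u \<noteq> c v" using assms that adj_in_verts[OF that] by (auto simp: coloring_def)
    then show ?thesis by (auto simp: c'_def)
  qed
  ultimately show ?thesis by (auto simp: coloring_def)
qed

text \<open>Numbering the vertices is a coloring, so the minimum in \<open>chromatic_number\<close>
  is attained.\<close>

lemma optimal_coloring:
  assumes "graph H"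
  obtains c where "coloring H (chromatic_number H) c"
proof -
  interpret graph H by fact
  obtain f where f: "bij_betw f (verts H) {1..card (verts H)}"
    using ex_bij_betw_nat_finite_1[OF finite_verts] bij_betw_inv by blast
  have "u \<noteq> v" if "u \<rightarrow>\<^bsub>H\<^esub> v" for u v using that dominates_irrefl[OF assms] by blast
  then have "coloring H (card (verts H)) f"
    using f adj_in_verts unfolding coloring_def bij_betw_def inj_on_def by blast
  then show thesis using that LeastI_ex[of "\<lambda>k. \<exists>c. coloring H k c"] by (auto simp: chromatic_number_def)
qed

lemma chromatic_number_le: "coloring H k c \<Longrightarrow> chromatic_number H \<le> k"
  unfolding chromatic_number_def by (rule Least_le) blast

lemma optimal_coloring_uses_all:
  assumes "graph H" "coloring H (chromatic_number H) c" "i \<in> {1..chromatic_number H}"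
  shows "\<exists>v\<in>verts H. c v = i"
proof (rule ccontr)
  assume "\<not> ?thesis"
  then obtain c' where "coloring H (chromatic_number H - 1) c'" using unused_color assms by blast
  then have "chromatic_number H \<le> chromatic_number H - 1" by (rule chromatic_number_le)
  then show False using assms(3) by auto
qed

lemma card_color_classes:
  assumes "\<forall>i\<in>{1..k}. \<exists>v\<in>verts H. c v = i"
  shows "card (color_classes H k c) = k"
proof -
  have "{} \<notin> (\<lambda>i. {v \<in> verts H. c v = i}) ` {1..k}" using assms by blast
  moreover have "inj_on (\<lambda>i. {v \<in> verts H. c v = i}) {1..k}"
  proof (rule inj_onI)
    fix i j assume ij: "i \<in> {1..k}" "{v \<in> verts H. c v = i} = {v \<in> verts H. c v = j}"
    obtain v where "v \<in> verts H" "c v = i" using assms ij(1) by blast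
    then show "i = j" using ij(2) by blast
  qed
  ultimately show ?thesis by (simp add: color_classes_def card_image)
qed

lemma card_color_classes_eqD:
  assumes "card (color_classes H k c) = k" "i \<in> {1..k}"
  shows "\<exists>v\<in>verts H. c v = i"
proof (rule ccontr)
  assume "\<not> ?thesis"
  then have "color_classes H k c \<subseteq> (\<lambda>i. {v \<in> verts H. c v = i}) ` ({1..k} - {i})"
    by (auto simp: color_classes_def)
  then have "card (color_classes H k c) \<le> card ({1..k} - {i})"
    by (rule surj_card_le[rotated]) simp
  then show False using assms by auto
qed

text \<open>Otherwise all vertices of a color class without b-vertex could be given other colors.\<close>

lemma optimal_coloring_b_coloring:
  assumes "graph H" "coloring H (chromatic_number H) c"
  shows "b_coloring H (chromatic_number H) c"
proof (rule ccontr)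
  assume "\<not> ?thesis"
  then obtain C where C: "C \<in> color_classes H (chromatic_number H) c"
    "\<forall>v\<in>C. \<not> b_vertex H (chromatic_number H) c v"
    using assms(2) by (auto simp: b_coloring_def)
  then obtain i where i: "i \<in> {1..chromatic_number H}" "C = {v \<in> verts H. c v = i}"
    unfolding color_classes_def by blast
  have no_b: "\<not> b_vertex H (chromatic_number H) c v" if "v \<in> verts H" "c v = i" for v
    using C(2) i(2) that by blast
  have "\<exists>j\<in>{1..chromatic_number H}. j \<noteq> i \<and> (\<forall>u\<in>verts H. c u = j \<longrightarrow> \<not> v \<rightarrow>\<^bsub>H\<^esub> u)"
    if v: "v \<in> verts H" "c v = i" for v
  proof -
    obtain C where C: "C \<in> color_classes H (chromatic_number H) c" "v \<notin> C" "\<forall>u\<in>C. \<not> v \<rightarrow>\<^bsub>H\<^esub> u"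
      using no_b[OF v] v(1) unfolding b_vertex_def by blast
    then obtain j where "j \<in> {1..chromatic_number H}" "C = {u \<in> verts H. c u = j}"
      unfolding color_classes_def by blast
    then show ?thesis using C(2,3) v by (intro bexI[of _ j]) auto
  qed
  then obtain j where j: "\<And>v. v \<in> verts H \<Longrightarrow> c v = i \<Longrightarrow> j v \<in> {1..chromatic_number H} \<and> j v \<noteq> i \<and>
      (\<forall>u\<in>verts H. c u = j v \<longrightarrow> \<not> v \<rightarrow>\<^bsub>H\<^esub> u)"
    by metis
  \<comment> \<open>Vertices of color \<open>i\<close> are pairwise nonadjacent, so recoloring all
    of them at once causes no conflict.\<close>
  define c' where "c' v = (if c v = i then j v else c v)" for v
  interpret graph H by fact
  have "c' u \<noteq> c' v" if uv: "u \<rightarrow>\<^bsub>H\<^esub> v" for u v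
    using adj_in_verts[OF uv] uv dominates_sym[OF assms(1) uv] j[of u] j[of v] assms(2)
    by (auto simp: c'_def coloring_def)
  moreover have "c' v \<in> {1..chromatic_number H}" if "v \<in> verts H" for v
    using that j[OF that] assms(2) by (simp add: c'_def coloring_def)
  ultimately have "coloring H (chromatic_number H) c'" by (auto simp: coloring_def)
  moreover have "\<forall>v\<in>verts H. c' v \<noteq> i" using j by (auto simp: c'_def)
  ultimately show False using optimal_coloring_uses_all assms(1) i by blast
qed

text \<open>One b-vertex is chosen per color; the other \<open>k - 1\<close> colors all occur among
  its neighbours.\<close>

lemma card_b_vertices:
  assumes "graph H" "b_coloring H k c" "card (color_classes H k c) = k"
  shows "k \<le> card {x \<in> verts H. k - 1 \<le> card (nbrs (dominates H) (verts H) x)}"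
proof -
  interpret graph H by fact
  note used = card_color_classes_eqD[OF assms(3)]
  have "\<exists>b\<in>verts H. c b = i \<and> (\<forall>j\<in>{1..k} - {i}. \<exists>u\<in>verts H. c u = j \<and> b \<rightarrow>\<^bsub>H\<^esub> u)" if i: "i \<in> {1..k}" for i
  proof -
    have class_in: "{v \<in> verts H. c v = j} \<in> color_classes H k c" if "j \<in> {1..k}" for j
      using used[OF that] that by (auto simp: color_classes_def)
    obtain b where b: "b \<in> verts H" "c b = i" "b_vertex H k c b"
      using assms(2) class_in[OF i] by (auto simp: b_coloring_def)
    have "\<exists>u\<in>verts H. c u = j \<and> b \<rightarrow>\<^bsub>H\<^esub> u" if "j \<in> {1..k} - {i}" for j
      using b class_in[of j] that by (auto simp: b_vertex_def)
    then show ?thesis using b by blast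
  qed
  then obtain b where b: "\<And>i. i \<in> {1..k} \<Longrightarrow> b i \<in> verts H \<and> c (b i) = i \<and>
      (\<forall>j\<in>{1..k} - {i}. \<exists>u\<in>verts H. c u = j \<and> b i \<rightarrow>\<^bsub>H\<^esub> u)"
    by metis
  have "k - 1 \<le> card (nbrs (dominates H) (verts H) (b i))" if i: "i \<in> {1..k}" for i
  proof -
    have "{1..k} - {i} \<subseteq> c ` nbrs (dominates H) (verts H) (b i)"
      using b[OF i] by (force simp: nbrs_def)
    moreover have "finite (nbrs (dominates H) (verts H) (b i))" by (simp add: nbrs_def)
    ultimately have "card ({1..k} - {i}) \<le> card (nbrs (dominates H) (verts H) (b i))"
      by (rule surj_card_le[rotated])
    then show ?thesis using i by simp
  qed
  then have "b ` {1..k} \<subseteq> {x \<in> verts H. k - 1 \<le> card (nbrs (dominates H) (verts H) x)}"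
    using b by auto
  moreover have "inj_on b {1..k}" by (rule inj_on_inverseI[where g = c]) (use b in blast)
  ultimately show ?thesis using card_inj_on_le[of b "{1..k}"] finite_verts by auto
qed

text \<open>For \<open>k\<close> above the chromatic number, \<open>k - 1\<close> still bounds all
  cliques, so \<open>bound\<close> at \<open>k - 1\<close> leaves too few vertices for the
  \<open>k\<close> b-vertices.\<close>

lemma b_chromatic_number_eqI:
  assumes H: "graph H"
    and bound: "\<And>k. (\<And>Q. Q \<subseteq> verts H \<Longrightarrow> clique (dominates H) Q \<Longrightarrow> card Q \<le> k) \<Longrightarrow>
      card {x \<in> verts H. k \<le> card (nbrs (dominates H) (verts H) x)} \<le> k"
  shows "b_chromatic_number H = chromatic_number H"
  unfolding b_chromatic_number_def
proof (rule Greatest_equality)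
  obtain c where c: "coloring H (chromatic_number H) c" using optimal_coloring[OF H] .
  have "card (color_classes H (chromatic_number H) c) = chromatic_number H"
    by (intro card_color_classes ballI optimal_coloring_uses_all[OF H c])
  then show "\<exists>c. b_coloring H (chromatic_number H) c \<and>
      card (color_classes H (chromatic_number H) c) = chromatic_number H"
    using optimal_coloring_b_coloring[OF H c] by blast
  fix k assume "\<exists>c. b_coloring H k c \<and> card (color_classes H k c) = k"
  then have k: "k \<le> card {x \<in> verts H. k - 1 \<le> card (nbrs (dominates H) (verts H) x)}"
    using card_b_vertices[OF H] by blast
  show "k \<le> chromatic_number H"
  proof (rule ccontr)
    assume n: "\<not> k \<le> chromatic_number H"
    have "card Q \<le> k - 1" if "Q \<subseteq> verts H" "clique (dominates H) Q" for Q
      using clique_card_le_coloring[OF c that] n by linarith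
    then have "card {x \<in> verts H. k - 1 \<le> card (nbrs (dominates H) (verts H) x)} \<le> k - 1"
      by (rule bound)
    then show False using k n by linarith
  qed
qed

theorem theorem1:
  fixes G :: "('a, 'b) pre_digraph"
  assumes "graph G"
    and "chordal G"
    and "\<And>F H. F \<in> forbidden_graphs \<Longrightarrow> induced_subgraph H G \<Longrightarrow> \<not> digraph_iso H F"
  shows "b_perfect G"
  unfolding b_perfect_def
proof (intro allI impI)
  fix H assume ind: "induced_subgraph H G"
  interpret graph G by fact
  interpret F: free_graph "dominates G" using free_graph_dominates assms by blast
  interpret HD: digraph H using digraphI_induced[OF ind] .
  interpret HS: sym_digraph H using induced_graph_imp_graph[OF ind] .
  have H: "graph H" by (rule HD.graphI[OF HS.sym_arcs])
  \<comment> \<open>Cliques and degrees in \<open>H\<close> are those of \<open>dominates G\<close>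
    inside \<open>verts H\<close>, so \<open>card_high_degree\<close> for \<open>G\<close> applies
    with \<open>verts H\<close> as vertex set.\<close>
  have adj: "x \<rightarrow>\<^bsub>H\<^esub> y \<longleftrightarrow> x \<rightarrow>\<^bsub>G\<^esub> y" if "x \<in> verts H" "y \<in> verts H" for x y
  proof -
    have "arcs H = {e \<in> arcs G. tail G e \<in> verts H \<and> head G e \<in> verts H}" "tail H = tail G" "head H = head G"
      using ind unfolding induced_subgraph_def subgraph_def compatible_def by metis+
    then show ?thesis using that unfolding arcs_ends_conv by auto
  qed
  have nbrs_eq: "nbrs (dominates H) (verts H) x = nbrs (dominates G) (verts H) x" if "x \<in> verts H" for x
    unfolding nbrs_def using adj[OF that] by (intro Collect_cong) blast
  have clique_eq: "clique (dominates H) Q \<longleftrightarrow> clique (dominates G) Q" if "Q \<subseteq> verts H" for Q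
    unfolding clique_def using adj subsetD[OF that] by (intro ball_cong refl) simp
  show "b_chromatic_number H = chromatic_number H"
  proof (rule b_chromatic_number_eqI[OF H])
    fix k assume "\<And>Q. Q \<subseteq> verts H \<Longrightarrow> clique (dominates H) Q \<Longrightarrow> card Q \<le> k"
    then have "card {x \<in> verts H. k \<le> card (nbrs (dominates G) (verts H) x)} \<le> k"
      using F.card_high_degree[OF HD.finite_verts] clique_eq by blast
    moreover have "{x \<in> verts H. k \<le> card (nbrs (dominates H) (verts H) x)} =
        {x \<in> verts H. k \<le> card (nbrs (dominates G) (verts H) x)}"
      using nbrs_eq by auto
    ultimately show "card {x \<in> verts H. k \<le> card (nbrs (dominates H) (verts H) x)} \<le> k" by simp
  qed
qed

end
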